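(* Let $M|N$ be a Frobenius extension of rings, with Frobenius homomorphism $E:M\to N$ and dual bases $\{x_i\},\{y_i\}$, and let $M_1=M\otimes_NM$ be the ring with the $E$-multiplication, regarded as a ring extension of $M$. If $M|N$ is left D2, then $M_1|M$ is right D2. Similarly, if $M|N$ is right D2, then $M_1|M$ is left D2.
   Context: Rings are unital; a ring extension $M|N$ is a unital ring homomorphism $N\to M$. It is left D2 if $M\otimes_NM$ is isomorphic as an $N$-$M$-bimodule to a direct summand of $\oplus^n\,{}_NM_M$ for some $n\ge1$, and right D2 if $M\otimes_NM$ is isomorphic as an $M$-$N$-bimodule to a direct summand of $\oplus^m\,{}_MM_N$ for some $m\ge1$. $M|N$ is Frobenius if there are an $N$-$N$-bimodule map $E:M\to N$ and finitely many $x_i,y_i\in M$ with $\sum_ix_iE(y_im)=m=\sum_iE(mx_i)y_i$ for all $m\in M$. The $E$-multiplication on $M_1=M\otimes_NM$ is $(m\otimes m')(m''\otimes m''')=mE(m'm'')\otimes m'''$ with unit $\sum_ix_i\otimes y_i$; the ring homomorphism $M\to M_1$ is $m\mapsto\sum_imx_i\otimes y_i$. ($M_1\cong\mathrm{End}(M_N)$ via $m\otimes m'\mapsto(x\mapsto mE(m'x))$.) *)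

theory Defs
  imports "HOL-Algebra.Module" "HOL-Algebra.RingHom" "HOL-Algebra.Free_Abelian_Groups" "HOL-Algebra.Generated_Groups"
begin

section \<open>Bimodules over not necessarily commutative rings\<close>

text \<open>
  The left action is the field \<open>smult\<close> inherited from the library record \<open>module\<close>; the library
  locale of that name is not used, because it requires a commutative ring. Only the additive
  structure of the underlying \<open>ring\<close> record is meaningful here; its fields \<open>mult\<close> and \<open>one\<close> are
  never used.
\<close>

record ('r, 's, 'a) bimodule = "('r, 'a) module" +
  rsmult :: "'a \<Rightarrow> 's \<Rightarrow> 'a"

definition bimodule_hom ::
    "('r, 'c) ring_scheme \<Rightarrow> ('s, 'd) ring_scheme \<Rightarrow> ('r, 's, 'a) bimodule \<Rightarrow>
      ('r, 's, 'b) bimodule \<Rightarrow> ('a \<Rightarrow> 'b) set" where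
  "bimodule_hom R S A B = {f \<in> carrier A \<rightarrow> carrier B.
     (\<forall>a\<in>carrier A. \<forall>a'\<in>carrier A. f (a \<oplus>\<^bsub>A\<^esub> a') = f a \<oplus>\<^bsub>B\<^esub> f a') \<and>
     (\<forall>r\<in>carrier R. \<forall>a\<in>carrier A. f (r \<odot>\<^bsub>A\<^esub> a) = r \<odot>\<^bsub>B\<^esub> f a) \<and>
     (\<forall>a\<in>carrier A. \<forall>s\<in>carrier S. f (rsmult A a s) = rsmult B (f a) s)}"

definition bimodule_iso ::
    "('r, 'c) ring_scheme \<Rightarrow> ('s, 'd) ring_scheme \<Rightarrow> ('r, 's, 'a) bimodule \<Rightarrow>
      ('r, 's, 'b) bimodule \<Rightarrow> ('a \<Rightarrow> 'b) set" where
  "bimodule_iso R S A B = {f \<in> bimodule_hom R S A B. bij_betw f (carrier A) (carrier B)}"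

definition sub_bimodule ::
    "('r, 'c) ring_scheme \<Rightarrow> ('s, 'd) ring_scheme \<Rightarrow> 'a set \<Rightarrow> ('r, 's, 'a) bimodule \<Rightarrow> bool" where
  "sub_bimodule R S P B \<longleftrightarrow> additive_subgroup P B \<and>
     (\<forall>r\<in>carrier R. \<forall>p\<in>P. r \<odot>\<^bsub>B\<^esub> p \<in> P) \<and> (\<forall>p\<in>P. \<forall>s\<in>carrier S. rsmult B p s \<in> P)"

definition direct_summand ::
    "('r, 'c) ring_scheme \<Rightarrow> ('s, 'd) ring_scheme \<Rightarrow> 'a set \<Rightarrow> ('r, 's, 'a) bimodule \<Rightarrow> bool" where
  "direct_summand R S P B \<longleftrightarrow> sub_bimodule R S P B \<and>
     (\<exists>Q. sub_bimodule R S Q B \<and> P \<inter> Q = {\<zero>\<^bsub>B\<^esub>} \<and> P <+>\<^bsub>B\<^esub> Q = carrier B)"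

definition iso_to_direct_summand ::
    "('r, 'c) ring_scheme \<Rightarrow> ('s, 'd) ring_scheme \<Rightarrow> ('r, 's, 'a) bimodule \<Rightarrow>
      ('r, 's, 'b) bimodule \<Rightarrow> bool" where
  "iso_to_direct_summand R S A B \<longleftrightarrow>
     (\<exists>P. direct_summand R S P B \<and> bimodule_iso R S A (B\<lparr>carrier := P\<rparr>) \<noteq> {})"

definition bimodule_power :: "nat \<Rightarrow> ('r, 's, 'a) bimodule \<Rightarrow> ('r, 's, nat \<Rightarrow> 'a) bimodule" where
  "bimodule_power n B =
     \<lparr>carrier = (\<Pi>\<^sub>E i\<in>{..<n}. carrier B), monoid.mult = undefined, one = undefined,
      ring.zero = (\<lambda>i\<in>{..<n}. \<zero>\<^bsub>B\<^esub>), add = (\<lambda>v w. \<lambda>i\<in>{..<n}. v i \<oplus>\<^bsub>B\<^esub> w i),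
      smult = (\<lambda>r v. \<lambda>i\<in>{..<n}. r \<odot>\<^bsub>B\<^esub> v i), rsmult = (\<lambda>v s. \<lambda>i\<in>{..<n}. rsmult B (v i) s)\<rparr>"

text \<open>
  A ring \<open>M\<close> as a bimodule over the sources of two ring homomorphisms \<open>f\<close> and \<open>g\<close> into it.
\<close>

definition restricted_bimodule ::
    "('r \<Rightarrow> 'm) \<Rightarrow> ('s \<Rightarrow> 'm) \<Rightarrow> ('m, 'd) ring_scheme \<Rightarrow> ('r, 's, 'm) bimodule" where
  "restricted_bimodule f g M =
     \<lparr>carrier = carrier M, monoid.mult = undefined, one = undefined,
      ring.zero = \<zero>\<^bsub>M\<^esub>, add = (\<lambda>a b. a \<oplus>\<^bsub>M\<^esub> b),
      smult = (\<lambda>r a. f r \<otimes>\<^bsub>M\<^esub> a), rsmult = (\<lambda>a s. a \<otimes>\<^bsub>M\<^esub> g s)\<rparr>"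

section \<open>Tensor products\<close>

text \<open>
  \<open>A \<otimes>\<^sub>S B\<close> is the free abelian group on \<open>carrier A \<times> carrier B\<close> modulo the subgroup generated by
  the usual relations. Its elements are cosets, that is, sets of formal integer combinations of
  pairs.
\<close>

definition tensor_free :: "('r, 's, 'a) bimodule \<Rightarrow> ('s, 't, 'b) bimodule \<Rightarrow> ('a \<times> 'b \<Rightarrow>\<^sub>0 int) monoid" where
  "tensor_free A B = free_Abelian_group (carrier A \<times> carrier B)"

definition tensor_relations ::
    "('s, 'c) ring_scheme \<Rightarrow> ('r, 's, 'a) bimodule \<Rightarrow> ('s, 't, 'b) bimodule \<Rightarrow> ('a \<times> 'b \<Rightarrow>\<^sub>0 int) set" where
  "tensor_relations S A B = generate (tensor_free A B)
    ({frag_of (a \<oplus>\<^bsub>A\<^esub> a', b) - frag_of (a, b) - frag_of (a', b) | a a' b.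
        a \<in> carrier A \<and> a' \<in> carrier A \<and> b \<in> carrier B} \<union>
     {frag_of (a, b \<oplus>\<^bsub>B\<^esub> b') - frag_of (a, b) - frag_of (a, b') | a b b'.
        a \<in> carrier A \<and> b \<in> carrier B \<and> b' \<in> carrier B} \<union>
     {frag_of (rsmult A a s, b) - frag_of (a, s \<odot>\<^bsub>B\<^esub> b) | a s b.
        a \<in> carrier A \<and> s \<in> carrier S \<and> b \<in> carrier B})"

definition tensor_class ::
    "('s, 'c) ring_scheme \<Rightarrow> ('r, 's, 'a) bimodule \<Rightarrow> ('s, 't, 'b) bimodule \<Rightarrow>
      ('a \<times> 'b \<Rightarrow>\<^sub>0 int) \<Rightarrow> ('a \<times> 'b \<Rightarrow>\<^sub>0 int) set" where
  "tensor_class S A B u = tensor_relations S A B #>\<^bsub>tensor_free A B\<^esub> u"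

definition pure_tensor ::
    "('s, 'c) ring_scheme \<Rightarrow> ('r, 's, 'a) bimodule \<Rightarrow> ('s, 't, 'b) bimodule \<Rightarrow> 'a \<Rightarrow> 'b \<Rightarrow>
      ('a \<times> 'b \<Rightarrow>\<^sub>0 int) set" where
  "pure_tensor S A B a b = tensor_class S A B (frag_of (a, b))"

text \<open>
  The actions are \<open>r (a \<otimes> b) = ra \<otimes> b\<close> and \<open>(a \<otimes> b) t = a \<otimes> bt\<close>, extended additively.
  They are computed on all representatives of a coset; since they respect the relations, the
  union below is over a family of equal cosets.
\<close>

definition tensor_product ::
    "('s, 'c) ring_scheme \<Rightarrow> ('r, 's, 'a) bimodule \<Rightarrow> ('s, 't, 'b) bimodule \<Rightarrow>
      ('r, 't, ('a \<times> 'b \<Rightarrow>\<^sub>0 int) set) bimodule" where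
  "tensor_product S A B = (let G = tensor_free A B Mod tensor_relations S A B in
     \<lparr>carrier = carrier G, monoid.mult = undefined, one = undefined,
      ring.zero = \<one>\<^bsub>G\<^esub>, add = (\<lambda>X Y. X \<otimes>\<^bsub>G\<^esub> Y),
      smult = (\<lambda>r X. \<Union>u\<in>X. tensor_class S A B (frag_extend (\<lambda>(a, b). frag_of (r \<odot>\<^bsub>A\<^esub> a, b)) u)),
      rsmult = (\<lambda>X t. \<Union>u\<in>X. tensor_class S A B (frag_extend (\<lambda>(a, b). frag_of (a, rsmult B b t)) u))\<rparr>)"

section \<open>Depth two extensions\<close>

text \<open>A ring extension \<open>M | N\<close> is a unital ring homomorphism \<open>\<iota> : N \<rightarrow> M\<close>, i.e. \<open>ring_hom_ring N M \<iota>\<close>.\<close>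

definition left_D2 :: "('n, 'c) ring_scheme \<Rightarrow> ('m, 'd) ring_scheme \<Rightarrow> ('n \<Rightarrow> 'm) \<Rightarrow> bool" where
  "left_D2 N M \<iota> \<longleftrightarrow> ring_hom_ring N M \<iota> \<and>
     (\<exists>n\<ge>1. iso_to_direct_summand N M
       (tensor_product N (restricted_bimodule \<iota> \<iota> M) (restricted_bimodule \<iota> id M))
       (bimodule_power n (restricted_bimodule \<iota> id M)))"

definition right_D2 :: "('n, 'c) ring_scheme \<Rightarrow> ('m, 'd) ring_scheme \<Rightarrow> ('n \<Rightarrow> 'm) \<Rightarrow> bool" where
  "right_D2 N M \<iota> \<longleftrightarrow> ring_hom_ring N M \<iota> \<and>
     (\<exists>n\<ge>1. iso_to_direct_summand M N
       (tensor_product N (restricted_bimodule id \<iota> M) (restricted_bimodule \<iota> \<iota> M))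
       (bimodule_power n (restricted_bimodule id \<iota> M)))"

section \<open>Frobenius extensions\<close>

locale frobenius_extension = ring_hom_ring N M \<iota>
  for N :: "('n, 'c) ring_scheme" (structure) and M :: "('m, 'd) ring_scheme" (structure) and \<iota> +
  fixes E :: "'m \<Rightarrow> 'n" and I :: "'i set" and x y :: "'i \<Rightarrow> 'm"
  assumes E_hom: "E \<in> bimodule_hom N N (restricted_bimodule \<iota> \<iota> M) (restricted_bimodule id id N)"
    and finite_I: "finite I"
    and x_closed: "x \<in> I \<rightarrow> carrier M"
    and y_closed: "y \<in> I \<rightarrow> carrier M"
    and dual_bases_left:
      "m \<in> carrier M \<Longrightarrow> (\<Oplus>\<^bsub>M\<^esub>i\<in>I. x i \<otimes>\<^bsub>M\<^esub> \<iota> (E (y i \<otimes>\<^bsub>M\<^esub> m))) = m"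
    and dual_bases_right:
      "m \<in> carrier M \<Longrightarrow> (\<Oplus>\<^bsub>M\<^esub>i\<in>I. \<iota> (E (m \<otimes>\<^bsub>M\<^esub> x i)) \<otimes>\<^bsub>M\<^esub> y i) = m"

definition ext_tensor ::
    "('n, 'c) ring_scheme \<Rightarrow> ('m, 'd) ring_scheme \<Rightarrow> ('n \<Rightarrow> 'm) \<Rightarrow>
      ('m, 'm, ('m \<times> 'm \<Rightarrow>\<^sub>0 int) set) bimodule" where
  "ext_tensor N M \<iota> = tensor_product N (restricted_bimodule id \<iota> M) (restricted_bimodule \<iota> id M)"

definition ext_pure_tensor ::
    "('n, 'c) ring_scheme \<Rightarrow> ('m, 'd) ring_scheme \<Rightarrow> ('n \<Rightarrow> 'm) \<Rightarrow> 'm \<Rightarrow> 'm \<Rightarrow>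
      ('m \<times> 'm \<Rightarrow>\<^sub>0 int) set" where
  "ext_pure_tensor N M \<iota> = pure_tensor N (restricted_bimodule id \<iota> M) (restricted_bimodule \<iota> id M)"

text \<open>
  The \<open>E\<close>-multiplication is the biadditive extension of
  \<open>(m \<otimes> m') (m'' \<otimes> m''') = m E(m' m'') \<otimes> m'''\<close>, computed on all representatives as above.
\<close>

definition E_mult ::
    "('n, 'c) ring_scheme \<Rightarrow> ('m, 'd) ring_scheme \<Rightarrow> ('n \<Rightarrow> 'm) \<Rightarrow> ('m \<Rightarrow> 'n) \<Rightarrow>
      ('m \<times> 'm \<Rightarrow>\<^sub>0 int) set \<Rightarrow> ('m \<times> 'm \<Rightarrow>\<^sub>0 int) set \<Rightarrow> ('m \<times> 'm \<Rightarrow>\<^sub>0 int) set" where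
  "E_mult N M \<iota> E X Y = (\<Union>u\<in>X. \<Union>v\<in>Y.
     tensor_class N (restricted_bimodule id \<iota> M) (restricted_bimodule \<iota> id M)
       (frag_extend (\<lambda>(m, m'). frag_extend (\<lambda>(m'', m''').
          frag_of (m \<otimes>\<^bsub>M\<^esub> \<iota> (E (m' \<otimes>\<^bsub>M\<^esub> m'')), m''')) v) u))"

definition basic_construction ::
    "('n, 'c) ring_scheme \<Rightarrow> ('m, 'd) ring_scheme \<Rightarrow> ('n \<Rightarrow> 'm) \<Rightarrow> ('m \<Rightarrow> 'n) \<Rightarrow>
      'i set \<Rightarrow> ('i \<Rightarrow> 'm) \<Rightarrow> ('i \<Rightarrow> 'm) \<Rightarrow> ('m \<times> 'm \<Rightarrow>\<^sub>0 int) set ring" where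
  "basic_construction N M \<iota> E I x y = (let T = ext_tensor N M \<iota> in
     \<lparr>carrier = carrier T, monoid.mult = E_mult N M \<iota> E,
      one = (\<Oplus>\<^bsub>T\<^esub>i\<in>I. ext_pure_tensor N M \<iota> (x i) (y i)),
      ring.zero = \<zero>\<^bsub>T\<^esub>, add = (\<lambda>X Y. X \<oplus>\<^bsub>T\<^esub> Y)\<rparr>)"

definition basic_construction_map ::
    "('n, 'c) ring_scheme \<Rightarrow> ('m, 'd) ring_scheme \<Rightarrow> ('n \<Rightarrow> 'm) \<Rightarrow>
      'i set \<Rightarrow> ('i \<Rightarrow> 'm) \<Rightarrow> ('i \<Rightarrow> 'm) \<Rightarrow> 'm \<Rightarrow> ('m \<times> 'm \<Rightarrow>\<^sub>0 int) set" where
  "basic_construction_map N M \<iota> I x y m =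
     (\<Oplus>\<^bsub>ext_tensor N M \<iota>\<^esub>i\<in>I. ext_pure_tensor N M \<iota> (m \<otimes>\<^bsub>M\<^esub> x i) (y i))"

end

theory Submission
  imports Defs
begin

text \<open>
  Depth two says that \<open>M \<otimes>\<^sub>N M\<close> is a retract of a power of \<open>M\<close>, that is, there are finitely many
  bimodule maps \<open>p\<^sub>i : M \<otimes>\<^sub>N M \<rightarrow> M\<close> and \<open>q\<^sub>i : M \<rightarrow> M \<otimes>\<^sub>N M\<close> with \<open>\<Sum>\<^sub>i q\<^sub>i p\<^sub>i = id\<close>. Since
  \<open>M\<^sub>1 \<otimes>\<^sub>M M\<^sub>1 \<cong> M \<otimes>\<^sub>N (M \<otimes>\<^sub>N M)\<close>, tensoring such maps with \<open>M\<close> over \<open>N\<close> on the left makes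
  \<open>M\<^sub>1 \<otimes>\<^sub>M M\<^sub>1\<close> a retract of a power of \<open>M \<otimes>\<^sub>N M = M\<^sub>1\<close>; \<open>M\<^sub>1 \<cong> End(M\<^sub>N)\<close> acts on the new tensor factor, so
  the induced maps are even \<open>M\<^sub>1\<close>-linear on the left. Explicitly, they are
  \<open>(a \<otimes> b) \<otimes> Y \<mapsto> a \<otimes> p\<^sub>i(b Y)\<close> and \<open>a \<otimes> b \<mapsto> (a \<otimes> 1) \<otimes> q\<^sub>i(b)\<close>. For right depth two one tensors on the right:
  \<open>X \<otimes> (c \<otimes> d) \<mapsto> p\<^sub>i(X c) \<otimes> d\<close> and \<open>a \<otimes> b \<mapsto> q\<^sub>i(a) \<otimes> (1 \<otimes> b)\<close>.
\<close>

section \<open>Additive maps and tensor products\<close>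

text \<open>The dual bases act through two facts. Hence restricting \<open>M1\<close> along
  \<open>\<iota>1\<close> returns the natural \<open>M\<close>-bimodule structure of the tensor
  square, which is why a tensor product over \<open>M\<close> of two copies of \<open>M1\<close>
  collapses to a threefold product over \<open>N\<close>. The \<open>N\<close>-linearity of
  \<open>E\<close> on both sides is what makes the product well defined and associative.

  The side of depth two switches because left D2 supplies maps that are \<open>N\<close>-linear on
  the left, just what is needed to put a further factor \<open>M\<close> in front. That factor
  carries the action of \<open>M1\<close>, while the linearity over \<open>M\<close> on the right is
  kept.

  The collapsing isomorphism is not constructed; the four maps are lifted directly from balanced
  maps. The encoding shapes the rest: actions and the \<open>E\<close>-product are unions over coset
  representatives, so even their additivity has to be proved. After that, an identity is shown by
  exhibiting both sides as additive maps and comparing them on pure tensors, one variable at a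
  time.\<close>

abbreviation add_hom :: "('a, 'c) ring_scheme \<Rightarrow> ('b, 'd) ring_scheme \<Rightarrow> ('a \<Rightarrow> 'b) set" where
  "add_hom A B \<equiv> hom (add_monoid A) (add_monoid B)"

lemma add_homI:
  assumes "\<And>a. a \<in> carrier A \<Longrightarrow> h a \<in> carrier B"
    and "\<And>a a'. a \<in> carrier A \<Longrightarrow> a' \<in> carrier A \<Longrightarrow> h (a \<oplus>\<^bsub>A\<^esub> a') = h a \<oplus>\<^bsub>B\<^esub> h a'"
  shows "h \<in> add_hom A B"
  using assms by (auto simp: hom_def)

lemma add_hom_closed: "h \<in> add_hom A B \<Longrightarrow> a \<in> carrier A \<Longrightarrow> h a \<in> carrier B"
  by (auto simp: hom_def)

lemma add_hom_add:
  "h \<in> add_hom A B \<Longrightarrow> a \<in> carrier A \<Longrightarrow> a' \<in> carrier A \<Longrightarrow> h (a \<oplus>\<^bsub>A\<^esub> a') = h a \<oplus>\<^bsub>B\<^esub> h a'"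
  by (auto simp: hom_def)

lemma add_hom_zero:
  assumes "abelian_group A" "abelian_group B" "h \<in> add_hom A B"
  shows "h \<zero>\<^bsub>A\<^esub> = \<zero>\<^bsub>B\<^esub>"
  using group_hom.hom_one[of "add_monoid A" "add_monoid B" h] assms
  by (simp add: group_hom_def group_hom_axioms_def abelian_group.a_group)

lemma add_hom_minus:
  assumes "abelian_group A" "abelian_group B" "h \<in> add_hom A B" "a \<in> carrier A"
  shows "h (\<ominus>\<^bsub>A\<^esub> a) = \<ominus>\<^bsub>B\<^esub> h a"
  using group_hom.hom_inv[of "add_monoid A" "add_monoid B" h] assms
  by (simp add: group_hom_def group_hom_axioms_def abelian_group.a_group a_inv_def)

lemma add_hom_finsum:
  assumes A: "abelian_group A" and B: "abelian_group B" and h: "h \<in> add_hom A B"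
    and f: "f \<in> J \<rightarrow> carrier A"
  shows "h (\<Oplus>\<^bsub>A\<^esub>i\<in>J. f i) = (\<Oplus>\<^bsub>B\<^esub>i\<in>J. h (f i))"
proof -
  interpret A: abelian_group A by fact
  interpret B: abelian_group B by fact
  note z = add_hom_zero[OF A B h]
  from f show ?thesis
  proof (induction J rule: infinite_finite_induct)
    case (insert j J)
    then show ?case
      by (simp add: Pi_def add_hom_add[OF h] add_hom_closed[OF h])
  qed (simp_all add: z)
qed

lemma add_hom_comp:
  "g \<in> add_hom A B \<Longrightarrow> h \<in> add_hom B C \<Longrightarrow> (\<lambda>a. h (g a)) \<in> add_hom A C"
  by (rule add_homI) (simp_all add: add_hom_closed[of g A B] add_hom_closed[of h B C]
      add_hom_add[of g A B] add_hom_add[of h B C])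

lemma add_hom_sum:
  assumes B: "abelian_group B" and g: "g \<in> add_hom A B" and h: "h \<in> add_hom A B"
  shows "(\<lambda>a. g a \<oplus>\<^bsub>B\<^esub> h a) \<in> add_hom A B"
proof -
  interpret B: abelian_group B by fact
  show ?thesis
    by (rule add_homI)
      (simp_all add: add_hom_add[OF g] add_hom_add[OF h] add_hom_closed[OF g] add_hom_closed[OF h] B.a_ac)
qed

section \<open>Tensor products as quotients of free abelian groups, and their universal
  property\<close>

lemma carrier_tensor_free: "u \<in> carrier (tensor_free A B) \<longleftrightarrow> Poly_Mapping.keys u \<subseteq> carrier A \<times> carrier B"
  by (simp add: tensor_free_def)

text \<open>Operations on cosets are encoded as unions over representatives. Such a union returns
  the common value only when there is a representative at all, hence the first premise.\<close>

lemma UN_eq_on_coset: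
  assumes "X \<noteq> {}" "\<And>u. u \<in> X \<Longrightarrow> f u = c"
  shows "(\<Union>u\<in>X. f u) = c"
  using assms by auto

text \<open>The data that the quotient group sees: two abelian groups and middle actions that stay
  inside their carriers. The outer actions are treated later, as additive endomorphisms of the
  quotient.\<close>

locale balanced_tensor = A: abelian_group A + B: abelian_group B
  for S :: "('s, 'c) ring_scheme" and A :: "('r, 's, 'a) bimodule" and B :: "('s, 't, 'b) bimodule" +
  assumes rsmult_closed: "a \<in> carrier A \<Longrightarrow> s \<in> carrier S \<Longrightarrow> rsmult A a s \<in> carrier A"
    and smult_closed: "s \<in> carrier S \<Longrightarrow> b \<in> carrier B \<Longrightarrow> s \<odot>\<^bsub>B\<^esub> b \<in> carrier B"
begin

text \<open>Separated from the subgroup generated by it, so that a kernel containing these elements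
  is known to contain all relations.\<close>

definition "relators =
    {frag_of (a \<oplus>\<^bsub>A\<^esub> a', b) - frag_of (a, b) - frag_of (a', b) | a a' b.
        a \<in> carrier A \<and> a' \<in> carrier A \<and> b \<in> carrier B} \<union>
     {frag_of (a, b \<oplus>\<^bsub>B\<^esub> b') - frag_of (a, b) - frag_of (a, b') | a b b'.
        a \<in> carrier A \<and> b \<in> carrier B \<and> b' \<in> carrier B} \<union>
     {frag_of (rsmult A a s, b) - frag_of (a, s \<odot>\<^bsub>B\<^esub> b) | a s b.
        a \<in> carrier A \<and> s \<in> carrier S \<and> b \<in> carrier B}"

lemma tensor_relations_eq: "tensor_relations S A B = generate (tensor_free A B) relators"
  by (simp add: tensor_relations_def relators_def)

lemma tensor_free_simps [simp]:
  "u \<otimes>\<^bsub>tensor_free A B\<^esub> v = u + v" "\<one>\<^bsub>tensor_free A B\<^esub> = 0"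
  "u \<in> carrier (tensor_free A B) \<Longrightarrow> inv\<^bsub>tensor_free A B\<^esub> u = - u"
  by (simp_all add: tensor_free_def)

sublocale F: comm_group "tensor_free A B"
  by (simp add: tensor_free_def abelian_free_Abelian_group)

lemma diff_tensor_free:
  assumes "u \<in> carrier (tensor_free A B)" "v \<in> carrier (tensor_free A B)"
  shows "u - v \<in> carrier (tensor_free A B)"
  using F.m_closed[OF assms(1) F.inv_closed[OF assms(2)]] assms(2) by simp

lemma frag_of_tensor_free:
  "a \<in> carrier A \<Longrightarrow> b \<in> carrier B \<Longrightarrow> frag_of (a, b) \<in> carrier (tensor_free A B)"
  by (simp add: tensor_free_def)

lemma relators_subset: "relators \<subseteq> carrier (tensor_free A B)"
  unfolding relators_def
  by (auto intro!: diff_tensor_free frag_of_tensor_free rsmult_closed smult_closed)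

lemma relations_subgroup: "subgroup (tensor_relations S A B) (tensor_free A B)"
  unfolding tensor_relations_eq by (rule F.generate_is_subgroup[OF relators_subset])

lemma relations_normal: "tensor_relations S A B \<lhd> tensor_free A B"
  by (rule F.subgroup_imp_normal[OF relations_subgroup])

abbreviation "T \<equiv> tensor_product S A B"

lemma add_monoid_T:
  "carrier T = carrier (tensor_free A B Mod tensor_relations S A B)"
  "X \<oplus>\<^bsub>T\<^esub> Y = X \<otimes>\<^bsub>tensor_free A B Mod tensor_relations S A B\<^esub> Y"
  "\<zero>\<^bsub>T\<^esub> = \<one>\<^bsub>tensor_free A B Mod tensor_relations S A B\<^esub>"
  by (simp_all add: tensor_product_def Let_def)

lemma abelian_group_T: "abelian_group T"
proof -
  interpret Q: comm_group "tensor_free A B Mod tensor_relations S A B"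
    by (rule F.abelian_FactGroup[OF relations_subgroup])
  show ?thesis
    by (rule abelian_groupI; unfold add_monoid_T)
      (assumption | rule Q.m_closed Q.one_closed Q.m_assoc Q.m_comm Q.l_one
        bexI[of _ "inv\<^bsub>tensor_free A B Mod tensor_relations S A B\<^esub> z" for z] Q.l_inv Q.inv_closed)+
qed

sublocale T: abelian_group T
  by (rule abelian_group_T)

lemma tensor_class_closed: "u \<in> carrier (tensor_free A B) \<Longrightarrow> tensor_class S A B u \<in> carrier T"
  by (auto simp: add_monoid_T FactGroup_def RCOSETS_def tensor_class_def)

lemma carrier_T_cases:
  assumes "X \<in> carrier T"
  obtains u where "u \<in> carrier (tensor_free A B)" "X = tensor_class S A B u"
  using assms by (auto simp: add_monoid_T FactGroup_def RCOSETS_def tensor_class_def)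

lemma tensor_class_add:
  assumes "u \<in> carrier (tensor_free A B)" "v \<in> carrier (tensor_free A B)"
  shows "tensor_class S A B (u + v) = tensor_class S A B u \<oplus>\<^bsub>T\<^esub> tensor_class S A B v"
  using normal.rcos_sum[OF relations_normal assms]
  by (simp add: add_monoid_T FactGroup_def tensor_class_def)

lemma tensor_class_zero: "tensor_class S A B 0 = \<zero>\<^bsub>T\<^esub>"
  using F.coset_mult_one[OF subgroup.subset[OF relations_subgroup]]
  by (simp add: add_monoid_T FactGroup_def tensor_class_def)

lemma tensor_class_diff:
  assumes "u \<in> carrier (tensor_free A B)" "v \<in> carrier (tensor_free A B)"
  shows "tensor_class S A B (u - v) = tensor_class S A B u \<ominus>\<^bsub>T\<^esub> tensor_class S A B v"
proof -
  have "tensor_class S A B (u - v) \<oplus>\<^bsub>T\<^esub> tensor_class S A B v = tensor_class S A B u"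
    using tensor_class_add[OF diff_tensor_free[OF assms] assms(2)] by simp
  then show ?thesis
    using T.add.inv_solve_right tensor_class_closed assms diff_tensor_free
    by (simp add: T.minus_eq)
qed

lemma tensor_class_relation:
  assumes "w \<in> relators"
  shows "tensor_class S A B w = \<zero>\<^bsub>T\<^esub>"
proof -
  have "w \<in> tensor_relations S A B"
    unfolding tensor_relations_eq by (rule generate.incl[OF assms])
  then show ?thesis
    using F.coset_join2[OF _ relations_subgroup] subgroup.mem_carrier[OF relations_subgroup]
    by (simp add: add_monoid_T FactGroup_def tensor_class_def)
qed

lemma mem_tensor_class:
  assumes "u \<in> carrier (tensor_free A B)" "v \<in> tensor_class S A B u"
  shows "v \<in> carrier (tensor_free A B)" "tensor_class S A B v = tensor_class S A B u"
  using F.repr_independence[OF assms(2)[unfolded tensor_class_def] assms(1) relations_subgroup]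
    F.r_coset_subset_G[OF subgroup.subset[OF relations_subgroup] assms(1)] assms(2)
  by (auto simp: tensor_class_def)

lemma tensor_class_nonempty:
  assumes "u \<in> carrier (tensor_free A B)"
  shows "tensor_class S A B u \<noteq> {}"
  using subgroup.one_closed[OF relations_subgroup] by (auto simp: tensor_class_def r_coset_def)

text \<open>
  The last clause evaluates the unions over representatives by which the actions on a tensor product
  and the \<open>E\<close>-multiplication are defined.
\<close>

lemma tensor_universal:
  assumes C: "abelian_group C"
    and h_closed: "\<And>u. u \<in> carrier (tensor_free A B) \<Longrightarrow> h u \<in> carrier C"
    and h_add: "\<And>u v. u \<in> carrier (tensor_free A B) \<Longrightarrow> v \<in> carrier (tensor_free A B) \<Longrightarrow> h (u + v) = h u \<oplus>\<^bsub>C\<^esub> h v"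
    and add_left: "\<And>a a' b. a \<in> carrier A \<Longrightarrow> a' \<in> carrier A \<Longrightarrow> b \<in> carrier B \<Longrightarrow>
      h (frag_of (a \<oplus>\<^bsub>A\<^esub> a', b)) = h (frag_of (a, b)) \<oplus>\<^bsub>C\<^esub> h (frag_of (a', b))"
    and add_right: "\<And>a b b'. a \<in> carrier A \<Longrightarrow> b \<in> carrier B \<Longrightarrow> b' \<in> carrier B \<Longrightarrow>
      h (frag_of (a, b \<oplus>\<^bsub>B\<^esub> b')) = h (frag_of (a, b)) \<oplus>\<^bsub>C\<^esub> h (frag_of (a, b'))"
    and balanced: "\<And>a s b. a \<in> carrier A \<Longrightarrow> s \<in> carrier S \<Longrightarrow> b \<in> carrier B \<Longrightarrow>
      h (frag_of (rsmult A a s, b)) = h (frag_of (a, s \<odot>\<^bsub>B\<^esub> b))"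
  shows "\<exists>H. H \<in> add_hom T C \<and> (\<forall>u\<in>carrier (tensor_free A B). H (tensor_class S A B u) = h u) \<and>
    (\<forall>X\<in>carrier T. X \<noteq> {} \<and> (\<forall>u\<in>X. h u = H X))"
proof -
  interpret C: abelian_group C by fact
  interpret h: group_hom "tensor_free A B" "add_monoid C" h
    by unfold_locales (use h_closed h_add in \<open>auto simp: hom_def\<close>)
  have h_diff: "h (u - v) = h u \<ominus>\<^bsub>C\<^esub> h v"
    if "u \<in> carrier (tensor_free A B)" "v \<in> carrier (tensor_free A B)" for u v
  proof -
    have "h (u - v) \<oplus>\<^bsub>C\<^esub> h v = h u"
      using h_add[OF diff_tensor_free[OF that] that(2)] by simp
    then show ?thesis
      using C.add.inv_solve_right h_closed that diff_tensor_free by (simp add: C.minus_eq)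
  qed
  have cancel: "p \<oplus>\<^bsub>C\<^esub> q \<ominus>\<^bsub>C\<^esub> p \<ominus>\<^bsub>C\<^esub> q = \<zero>\<^bsub>C\<^esub>" if "p \<in> carrier C" "q \<in> carrier C" for p q
    using that
    by (simp add: C.minus_eq C.a_assoc C.a_lcomm[of q "\<ominus>\<^bsub>C\<^esub> p" "\<ominus>\<^bsub>C\<^esub> q"] C.r_neg)
  have self: "p \<ominus>\<^bsub>C\<^esub> p = \<zero>\<^bsub>C\<^esub>" if "p \<in> carrier C" for p
    using that by (simp add: C.minus_eq C.r_neg)
  have "relators \<subseteq> kernel (tensor_free A B) (add_monoid C) h"
  proof
    fix w assume w: "w \<in> relators"
    have "h w = \<zero>\<^bsub>C\<^esub>"
      using w unfolding relators_def
      by (auto simp: h_diff diff_tensor_free frag_of_tensor_free rsmult_closed smult_closed h_closed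
          add_left add_right balanced cancel self)
    then show "w \<in> kernel (tensor_free A B) (add_monoid C) h"
      using w relators_subset by (auto simp: kernel_def)
  qed
  then have "tensor_relations S A B \<subseteq> kernel (tensor_free A B) (add_monoid C) h"
    unfolding tensor_relations_eq by (rule F.generate_subgroup_incl[OF _ h.subgroup_kernel])
  then obtain H where H: "H \<in> hom (tensor_free A B Mod tensor_relations S A B) (add_monoid C)"
    "\<And>u. u \<in> carrier (tensor_free A B) \<Longrightarrow> H (tensor_class S A B u) = h u"
    using h.FactGroup_universal_kernel[OF relations_normal] unfolding tensor_class_def by blast
  show ?thesis
  proof (intro exI[of _ H] conjI ballI)
    show "H \<in> add_hom T C"
      using H(1) by (auto simp: hom_def add_monoid_T)
    show "H (tensor_class S A B u) = h u" if "u \<in> carrier (tensor_free A B)" for u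
      by (rule H(2)[OF that])
    fix X assume X: "X \<in> carrier T"
    obtain u where u: "u \<in> carrier (tensor_free A B)" "X = tensor_class S A B u"
      using X by (rule carrier_T_cases)
    show "X \<noteq> {}"
      using tensor_class_nonempty[OF u(1)] u(2) by simp
    fix v assume "v \<in> X"
    then show "h v = H X"
      using mem_tensor_class[OF u(1)] H(2) unfolding u(2) by metis
  qed
qed

lemma pure_closed: "a \<in> carrier A \<Longrightarrow> b \<in> carrier B \<Longrightarrow> pure_tensor S A B a b \<in> carrier T"
  unfolding pure_tensor_def by (intro tensor_class_closed frag_of_tensor_free)

lemma tensor_class_eqI:
  assumes "u \<in> carrier (tensor_free A B)" "v \<in> carrier (tensor_free A B)" "u - v \<in> relators"
  shows "tensor_class S A B u = tensor_class S A B v"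
proof -
  have "tensor_class S A B u = tensor_class S A B (u - v) \<oplus>\<^bsub>T\<^esub> tensor_class S A B v"
    using tensor_class_add[OF diff_tensor_free[OF assms(1,2)] assms(2)] by simp
  then show ?thesis
    using tensor_class_relation[OF assms(3)] tensor_class_closed[OF assms(2)] by simp
qed

lemma add_tensor_free:
  assumes "u \<in> carrier (tensor_free A B)" "v \<in> carrier (tensor_free A B)"
  shows "u + v \<in> carrier (tensor_free A B)"
  using F.m_closed[OF assms] by simp

lemma pure_add_left:
  assumes "a \<in> carrier A" "a' \<in> carrier A" "b \<in> carrier B"
  shows "pure_tensor S A B (a \<oplus>\<^bsub>A\<^esub> a') b = pure_tensor S A B a b \<oplus>\<^bsub>T\<^esub> pure_tensor S A B a' b"
proof -
  have "frag_of (a \<oplus>\<^bsub>A\<^esub> a', b) - (frag_of (a, b) + frag_of (a', b)) \<in> relators"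
    unfolding relators_def diff_diff_eq[symmetric] using assms by blast
  then show ?thesis
    unfolding pure_tensor_def
    using assms by (subst tensor_class_add[symmetric])
      (simp_all add: tensor_class_eqI add_tensor_free frag_of_tensor_free)
qed

lemma pure_add_right:
  assumes "a \<in> carrier A" "b \<in> carrier B" "b' \<in> carrier B"
  shows "pure_tensor S A B a (b \<oplus>\<^bsub>B\<^esub> b') = pure_tensor S A B a b \<oplus>\<^bsub>T\<^esub> pure_tensor S A B a b'"
proof -
  have "frag_of (a, b \<oplus>\<^bsub>B\<^esub> b') - (frag_of (a, b) + frag_of (a, b')) \<in> relators"
    unfolding relators_def diff_diff_eq[symmetric] using assms by blast
  then show ?thesis
    unfolding pure_tensor_def
    using assms by (subst tensor_class_add[symmetric])
      (simp_all add: tensor_class_eqI add_tensor_free frag_of_tensor_free)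
qed

lemma pure_balanced:
  assumes "a \<in> carrier A" "s \<in> carrier S" "b \<in> carrier B"
  shows "pure_tensor S A B (rsmult A a s) b = pure_tensor S A B a (s \<odot>\<^bsub>B\<^esub> b)"
proof -
  have "frag_of (rsmult A a s, b) - frag_of (a, s \<odot>\<^bsub>B\<^esub> b) \<in> relators"
    unfolding relators_def using assms by blast
  then show ?thesis
    unfolding pure_tensor_def using assms
    by (intro tensor_class_eqI frag_of_tensor_free rsmult_closed smult_closed)
qed

lemma pure_left_hom: "b \<in> carrier B \<Longrightarrow> (\<lambda>a. pure_tensor S A B a b) \<in> add_hom A T"
  by (rule add_homI) (auto simp: pure_closed pure_add_left)

text \<open>No case for negatives or zero is required because -(a \<otimes> b) = (-a) \<otimes> b
  and 0 = 0 \<otimes> 0: sums of pure tensors exhaust the quotient.\<close>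

lemma tensor_induct [consumes 1, case_names pure add]:
  assumes X: "X \<in> carrier T"
    and pure: "\<And>a b. a \<in> carrier A \<Longrightarrow> b \<in> carrier B \<Longrightarrow> P (pure_tensor S A B a b)"
    and add: "\<And>X Y. X \<in> carrier T \<Longrightarrow> Y \<in> carrier T \<Longrightarrow> P X \<Longrightarrow> P Y \<Longrightarrow> P (X \<oplus>\<^bsub>T\<^esub> Y)"
  shows "P X"
proof -
  have P0: "P \<zero>\<^bsub>T\<^esub>"
    using pure[OF A.zero_closed B.zero_closed]
      add_hom_zero[OF A.abelian_group_axioms abelian_group_T pure_left_hom[OF B.zero_closed]] by simp
  have zero_minus: "\<ominus>\<^bsub>T\<^esub> \<zero>\<^bsub>T\<^esub> = \<zero>\<^bsub>T\<^esub>"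
    by (rule T.minus_equality) simp_all
  \<comment> \<open>\<open>frag_induction\<close> builds formal sums by differences, whereas the
    hypotheses offer sums. Carrying the claim for the negative along lets u - v be read as u +
    (-v).\<close>
  let ?Q = "\<lambda>X. X \<in> carrier T \<and> P X \<and> P (\<ominus>\<^bsub>T\<^esub> X)"
  obtain u where u: "u \<in> carrier (tensor_free A B)" "X = tensor_class S A B u"
    using carrier_T_cases[OF X] .
  have "Poly_Mapping.keys u \<subseteq> carrier A \<times> carrier B"
    using u(1) by (simp add: carrier_tensor_free)
  then have "u \<in> carrier (tensor_free A B) \<and> ?Q (tensor_class S A B u)"
  proof (induction u rule: frag_induction)
    case zero
    then show ?case
      using P0 F.one_closed by (simp add: tensor_class_zero zero_minus)
  next
    case (one z)
    then obtain a b where z: "z = (a, b)" "a \<in> carrier A" "b \<in> carrier B" by auto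
    have "\<ominus>\<^bsub>T\<^esub> pure_tensor S A B a b = pure_tensor S A B (\<ominus>\<^bsub>A\<^esub> a) b"
      using add_hom_minus[OF A.abelian_group_axioms abelian_group_T pure_left_hom] z by simp
    then show ?case
      using z pure[of a b] pure[of "\<ominus>\<^bsub>A\<^esub> a" b] pure_closed[of a b] frag_of_tensor_free[of a b]
      by (simp add: pure_tensor_def)
  next
    case (diff u v)
    let ?u = "tensor_class S A B u" and ?v = "tensor_class S A B v"
    from diff have c: "u \<in> carrier (tensor_free A B)" "v \<in> carrier (tensor_free A B)" "?u \<in> carrier T"
      "?v \<in> carrier T" and P: "P ?u" "P ?v" "P (\<ominus>\<^bsub>T\<^esub> ?u)" "P (\<ominus>\<^bsub>T\<^esub> ?v)" by auto
    have "\<ominus>\<^bsub>T\<^esub> (?u \<ominus>\<^bsub>T\<^esub> ?v) = \<ominus>\<^bsub>T\<^esub> ?u \<oplus>\<^bsub>T\<^esub> ?v"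
      using c by (simp add: T.minus_eq T.minus_add)
    then show ?case
      using add[OF c(3) T.a_inv_closed[OF c(4)] P(1,4)] add[OF T.a_inv_closed[OF c(3)] c(4) P(3,2)] c
      by (simp only: tensor_class_diff diff_tensor_free T.minus_eq T.a_closed T.a_inv_closed simp_thms)
  qed
  then show ?thesis
    using u by simp
qed

text \<open>The uniqueness half of the universal property, since pure tensors generate. It replaces
  nearly all calculation with cosets later on.\<close>

lemma tensor_hom_eqI:
  assumes "g \<in> add_hom T C" "h \<in> add_hom T C" "X \<in> carrier T"
    and "\<And>a b. a \<in> carrier A \<Longrightarrow> b \<in> carrier B \<Longrightarrow> g (pure_tensor S A B a b) = h (pure_tensor S A B a b)"
  shows "g X = h X"
  using assms(3)
proof (induction X rule: tensor_induct)
  case (add X Y)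
  then show ?case
    by (simp add: add_hom_add[OF assms(1)] add_hom_add[OF assms(2)])
qed (rule assms(4))

text \<open>The existence half. A map on pairs extends to the free abelian group, and biadditivity
  and balance say that this extension satisfies the conditions of
  \<open>tensor_universal\<close>.\<close>

lemma tensor_lift:
  assumes C: "abelian_group C"
    and closed: "\<And>a b. a \<in> carrier A \<Longrightarrow> b \<in> carrier B \<Longrightarrow> \<phi> a b \<in> carrier C"
    and add_left: "\<And>a a' b. a \<in> carrier A \<Longrightarrow> a' \<in> carrier A \<Longrightarrow> b \<in> carrier B \<Longrightarrow>
      \<phi> (a \<oplus>\<^bsub>A\<^esub> a') b = \<phi> a b \<oplus>\<^bsub>C\<^esub> \<phi> a' b"
    and add_right: "\<And>a b b'. a \<in> carrier A \<Longrightarrow> b \<in> carrier B \<Longrightarrow> b' \<in> carrier B \<Longrightarrow>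
      \<phi> a (b \<oplus>\<^bsub>B\<^esub> b') = \<phi> a b \<oplus>\<^bsub>C\<^esub> \<phi> a b'"
    and balanced: "\<And>a s b. a \<in> carrier A \<Longrightarrow> s \<in> carrier S \<Longrightarrow> b \<in> carrier B \<Longrightarrow>
      \<phi> (rsmult A a s) b = \<phi> a (s \<odot>\<^bsub>B\<^esub> b)"
  shows "\<exists>H. H \<in> add_hom T C \<and>
    (\<forall>a\<in>carrier A. \<forall>b\<in>carrier B. H (pure_tensor S A B a b) = \<phi> a b)"
proof -
  interpret C: abelian_group C by fact
  have im: "(\<lambda>(a, b). \<phi> a b) ` (carrier A \<times> carrier B) \<subseteq> carrier C"
    using closed by auto
  obtain h where h: "h \<in> hom (tensor_free A B) (add_monoid C)"
    "\<And>z. z \<in> carrier A \<times> carrier B \<Longrightarrow> h (frag_of z) = (\<lambda>(a, b). \<phi> a b) z"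
    by (rule C.add.free_Abelian_group_universal[OF im, folded tensor_free_def[of A B]], rule that)
  have frag: "h (frag_of (a, b)) = \<phi> a b" if "a \<in> carrier A" "b \<in> carrier B" for a b
    using h(2)[of "(a, b)"] that by simp
  have "\<exists>H. H \<in> add_hom T C \<and> (\<forall>u\<in>carrier (tensor_free A B). H (tensor_class S A B u) = h u) \<and>
    (\<forall>X\<in>carrier T. X \<noteq> {} \<and> (\<forall>u\<in>X. h u = H X))"
  proof (rule tensor_universal[OF C])
    show "h u \<in> carrier C" if "u \<in> carrier (tensor_free A B)" for u
      using hom_in_carrier[OF h(1) that] by simp
    show "h (u + v) = h u \<oplus>\<^bsub>C\<^esub> h v"
      if "u \<in> carrier (tensor_free A B)" "v \<in> carrier (tensor_free A B)" for u v
      using hom_mult[OF h(1) that] by simp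
  qed (use frag add_left add_right balanced smult_closed rsmult_closed in simp_all)
  then obtain H where H: "H \<in> add_hom T C"
    "\<And>u. u \<in> carrier (tensor_free A B) \<Longrightarrow> H (tensor_class S A B u) = h u"
    by blast
  have "H (pure_tensor S A B a b) = \<phi> a b" if "a \<in> carrier A" "b \<in> carrier B" for a b
    unfolding pure_tensor_def using H(2)[OF frag_of_tensor_free[OF that]] frag[OF that] by simp
  then show ?thesis
    using H(1) by blast
qed

end

section \<open>Bimodules and direct summands of powers\<close>

text \<open>The fragment of the bimodule axioms with which summands are traded for retractions:
  every scalar acts as an additive endomorphism.\<close>

locale two_sided_module = abelian_group A
  for R :: "('r, 'c) ring_scheme" and S :: "('s, 'd) ring_scheme" and A :: "('r, 's, 'a) bimodule" +
  assumes smult_closed: "r \<in> carrier R \<Longrightarrow> a \<in> carrier A \<Longrightarrow> r \<odot>\<^bsub>A\<^esub> a \<in> carrier A"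
    and rsmult_closed: "a \<in> carrier A \<Longrightarrow> s \<in> carrier S \<Longrightarrow> rsmult A a s \<in> carrier A"
    and smult_add: "r \<in> carrier R \<Longrightarrow> a \<in> carrier A \<Longrightarrow> a' \<in> carrier A \<Longrightarrow>
      r \<odot>\<^bsub>A\<^esub> (a \<oplus>\<^bsub>A\<^esub> a') = r \<odot>\<^bsub>A\<^esub> a \<oplus>\<^bsub>A\<^esub> r \<odot>\<^bsub>A\<^esub> a'"
    and rsmult_add: "a \<in> carrier A \<Longrightarrow> a' \<in> carrier A \<Longrightarrow> s \<in> carrier S \<Longrightarrow>
      rsmult A (a \<oplus>\<^bsub>A\<^esub> a') s = rsmult A a s \<oplus>\<^bsub>A\<^esub> rsmult A a' s"
begin

lemma smult_hom: "r \<in> carrier R \<Longrightarrow> (\<lambda>a. r \<odot>\<^bsub>A\<^esub> a) \<in> add_hom A A"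
  by (rule add_homI) (simp_all add: smult_closed smult_add)

lemma rsmult_hom: "s \<in> carrier S \<Longrightarrow> (\<lambda>a. rsmult A a s) \<in> add_hom A A"
  by (rule add_homI) (simp_all add: rsmult_closed rsmult_add)

lemma smult_zero: "r \<in> carrier R \<Longrightarrow> r \<odot>\<^bsub>A\<^esub> \<zero>\<^bsub>A\<^esub> = \<zero>\<^bsub>A\<^esub>"
  by (rule add_hom_zero[OF abelian_group_axioms abelian_group_axioms smult_hom])

lemma rsmult_zero: "s \<in> carrier S \<Longrightarrow> rsmult A \<zero>\<^bsub>A\<^esub> s = \<zero>\<^bsub>A\<^esub>"
  by (rule add_hom_zero[OF abelian_group_axioms abelian_group_axioms rsmult_hom])

end

section \<open>Direct summands as retracts\<close>

lemma bimodule_hom_iff: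
  "f \<in> bimodule_hom R S A B \<longleftrightarrow> f \<in> add_hom A B \<and>
    (\<forall>r\<in>carrier R. \<forall>a\<in>carrier A. f (r \<odot>\<^bsub>A\<^esub> a) = r \<odot>\<^bsub>B\<^esub> f a) \<and>
    (\<forall>a\<in>carrier A. \<forall>s\<in>carrier S. f (rsmult A a s) = rsmult B (f a) s)"
  by (auto simp: bimodule_hom_def hom_def)

text \<open>The retraction is the projection onto \<open>P\<close> along its complement
  \<open>Q\<close>, followed by the inverse of the isomorphism from \<open>A\<close> onto
  \<open>P\<close>.\<close>

lemma direct_summand_retraction:
  assumes A: "two_sided_module R S A" and C: "two_sided_module R S C"
    and iso: "iso_to_direct_summand R S A C"
  shows "\<exists>\<phi>\<in>bimodule_hom R S A C. \<exists>\<psi>\<in>bimodule_hom R S C A. \<forall>a\<in>carrier A. \<psi> (\<phi> a) = a"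
proof -
  interpret A: two_sided_module R S A by fact
  interpret C: two_sided_module R S C by fact
  from iso obtain P Q \<phi> where P: "sub_bimodule R S P C" and Q: "sub_bimodule R S Q C"
    and PQ: "P \<inter> Q = {\<zero>\<^bsub>C\<^esub>}" "P <+>\<^bsub>C\<^esub> Q = carrier C"
    and \<phi>: "\<phi> \<in> bimodule_iso R S A (C\<lparr>carrier := P\<rparr>)"
    unfolding iso_to_direct_summand_def direct_summand_def by blast
  interpret P: additive_subgroup P C
    using P by (simp add: sub_bimodule_def)
  interpret Q: additive_subgroup Q C
    using Q by (simp add: sub_bimodule_def)
  have Q_act: "r \<odot>\<^bsub>C\<^esub> q \<in> Q" if "r \<in> carrier R" "q \<in> Q" for r q
    using Q that by (simp add: sub_bimodule_def)
  have Q_ract: "rsmult C q s \<in> Q" if "s \<in> carrier S" "q \<in> Q" for s q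
    using Q that by (simp add: sub_bimodule_def)
  have \<phi>P: "\<phi> ` carrier A = P" and inj: "inj_on \<phi> (carrier A)"
    using \<phi> by (auto simp: bimodule_iso_def bij_betw_def)
  have \<phi>_closed: "\<phi> a \<in> P" if "a \<in> carrier A" for a
    using \<phi>P that by auto
  have P_sub: "p \<in> carrier C" if "p \<in> P" for p
    using that P.a_subset by auto
  have Q_sub: "p \<in> carrier C" if "p \<in> Q" for p
    using that Q.a_subset by auto
  have \<phi>_hom: "\<phi> \<in> bimodule_hom R S A C"
  proof -
    have "\<phi> \<in> carrier A \<rightarrow> carrier C"
      using P_sub[OF \<phi>_closed] by blast
    then show ?thesis
      using \<phi> by (simp add: bimodule_iso_def bimodule_hom_def)
  qed
  have \<phi>_add: "\<phi> (a \<oplus>\<^bsub>A\<^esub> a') = \<phi> a \<oplus>\<^bsub>C\<^esub> \<phi> a'" if "a \<in> carrier A" "a' \<in> carrier A" for a a'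
    using \<phi>_hom that by (simp add: bimodule_hom_def)
  \<comment> \<open>The \<open>A\<close>-component of a decomposition is unique: \<phi> a - \<phi>
    a' = q' - q lies in both \<open>P\<close> and \<open>Q\<close>, so it vanishes, and
    \<open>\<phi>\<close> is injective.\<close>
  have uniq: "a = a'" if a: "a \<in> carrier A" "a' \<in> carrier A" "q \<in> Q" "q' \<in> Q"
    and eq: "\<phi> a \<oplus>\<^bsub>C\<^esub> q = \<phi> a' \<oplus>\<^bsub>C\<^esub> q'" for a a' q q'
  proof -
    note car = P_sub[OF \<phi>_closed[OF a(1)]] P_sub[OF \<phi>_closed[OF a(2)]] Q_sub[OF a(3)] Q_sub[OF a(4)]
    have "\<phi> a = (\<phi> a \<oplus>\<^bsub>C\<^esub> q) \<oplus>\<^bsub>C\<^esub> \<ominus>\<^bsub>C\<^esub> q"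
      using car by (simp add: C.a_assoc C.r_neg)
    also have "\<dots> = \<phi> a' \<oplus>\<^bsub>C\<^esub> (q' \<oplus>\<^bsub>C\<^esub> \<ominus>\<^bsub>C\<^esub> q)"
      unfolding eq using car by (simp add: C.a_assoc)
    finally have e0: "\<phi> a = \<phi> a' \<oplus>\<^bsub>C\<^esub> (q' \<oplus>\<^bsub>C\<^esub> \<ominus>\<^bsub>C\<^esub> q)" .
    have e: "\<phi> a \<ominus>\<^bsub>C\<^esub> \<phi> a' = q' \<ominus>\<^bsub>C\<^esub> q"
      unfolding C.minus_eq using car
      by (subst e0, subst C.a_comm) (simp_all add: C.r_neg1)
    moreover have "\<phi> a \<ominus>\<^bsub>C\<^esub> \<phi> a' \<in> P"
      using a(1,2) \<phi>_closed by (simp add: C.minus_eq)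
    moreover have "q' \<ominus>\<^bsub>C\<^esub> q \<in> Q"
      using a(3,4) by (simp add: C.minus_eq)
    ultimately have "q' \<ominus>\<^bsub>C\<^esub> q = \<zero>\<^bsub>C\<^esub>"
      using PQ(1) by auto
    then have "\<phi> a = \<phi> a'"
      using e0 car by (simp add: C.minus_eq)
    then show ?thesis
      using inj a(1,2) by (simp add: inj_on_def)
  qed
  \<comment> \<open>This selects the \<open>A\<close>-component of \<open>v\<close>;
    \<open>split\<close> gives its existence and \<open>uniq\<close> its uniqueness. Linearity then
    comes from adding or scaling decompositions, as \<open>Q\<close> is stable under these
    operations too.\<close>
  define \<psi> where "\<psi> v = (THE a. a \<in> carrier A \<and> (\<exists>q\<in>Q. v = \<phi> a \<oplus>\<^bsub>C\<^esub> q))" for v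
  have \<psi>_eq: "\<psi> (\<phi> a \<oplus>\<^bsub>C\<^esub> q) = a" if "a \<in> carrier A" "q \<in> Q" for a q
    unfolding \<psi>_def using that uniq by (intro the_equality) blast+
  have split: "\<exists>a\<in>carrier A. \<exists>q\<in>Q. v = \<phi> a \<oplus>\<^bsub>C\<^esub> q" if "v \<in> carrier C" for v
    using that unfolding PQ(2)[symmetric] set_add_def' \<phi>P[symmetric] by auto
  have "\<psi> \<in> bimodule_hom R S C A"
    unfolding bimodule_hom_def
  proof (safe)
    fix v assume "v \<in> carrier C"
    then show "\<psi> v \<in> carrier A"
      using split \<psi>_eq by metis
  next
    fix v w assume "v \<in> carrier C" "w \<in> carrier C"
    then obtain a q a' q' where aq: "a \<in> carrier A" "q \<in> Q" "v = \<phi> a \<oplus>\<^bsub>C\<^esub> q"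
      "a' \<in> carrier A" "q' \<in> Q" "w = \<phi> a' \<oplus>\<^bsub>C\<^esub> q'"
      using split by metis
    have "v \<oplus>\<^bsub>C\<^esub> w = \<phi> (a \<oplus>\<^bsub>A\<^esub> a') \<oplus>\<^bsub>C\<^esub> (q \<oplus>\<^bsub>C\<^esub> q')"
      using aq by (simp add: \<phi>_add P_sub[OF \<phi>_closed] Q_sub C.a_ac)
    then show "\<psi> (v \<oplus>\<^bsub>C\<^esub> w) = \<psi> v \<oplus>\<^bsub>A\<^esub> \<psi> w"
      using aq by (simp add: \<psi>_eq)
  next
    fix r v assume r: "r \<in> carrier R" and "v \<in> carrier C"
    then obtain a q where aq: "a \<in> carrier A" "q \<in> Q" "v = \<phi> a \<oplus>\<^bsub>C\<^esub> q"
      using split by metis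
    have "r \<odot>\<^bsub>C\<^esub> v = \<phi> (r \<odot>\<^bsub>A\<^esub> a) \<oplus>\<^bsub>C\<^esub> r \<odot>\<^bsub>C\<^esub> q"
      using aq r \<phi>_hom by (simp add: C.smult_add P_sub[OF \<phi>_closed] Q_sub bimodule_hom_def)
    then show "\<psi> (r \<odot>\<^bsub>C\<^esub> v) = r \<odot>\<^bsub>A\<^esub> \<psi> v"
      using aq r by (simp add: \<psi>_eq A.smult_closed Q_act)
  next
    fix v s assume s: "s \<in> carrier S" and "v \<in> carrier C"
    then obtain a q where aq: "a \<in> carrier A" "q \<in> Q" "v = \<phi> a \<oplus>\<^bsub>C\<^esub> q"
      using split by metis
    have "rsmult C v s = \<phi> (rsmult A a s) \<oplus>\<^bsub>C\<^esub> rsmult C q s"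
      using aq s \<phi>_hom by (simp add: C.rsmult_add P_sub[OF \<phi>_closed] Q_sub bimodule_hom_def)
    then show "\<psi> (rsmult C v s) = rsmult A (\<psi> v) s"
      using aq s by (simp add: \<psi>_eq A.rsmult_closed Q_ract)
  qed
  moreover have "\<psi> (\<phi> a) = a" if "a \<in> carrier A" for a
    using \<psi>_eq[OF that Q.zero_closed] P_sub[OF \<phi>_closed[OF that]] by simp
  ultimately show ?thesis
    using \<phi>_hom by blast
qed

text \<open>The image of \<open>\<phi>\<close> and the kernel of \<open>\<psi>\<close> are
  complementary: in v = \<phi> (\<psi> v) + (v - \<phi> (\<psi> v)) the second term is killed by
  \<open>\<psi>\<close>, and an element \<phi> a of the kernel has a = \<psi> (\<phi> a) =
  0.\<close>

lemma retraction_direct_summand: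
  assumes A: "two_sided_module R S A" and C: "two_sided_module R S C"
    and \<phi>: "\<phi> \<in> bimodule_hom R S A C" and \<psi>: "\<psi> \<in> bimodule_hom R S C A"
    and retract: "\<And>a. a \<in> carrier A \<Longrightarrow> \<psi> (\<phi> a) = a"
  shows "iso_to_direct_summand R S A C"
proof -
  interpret A: two_sided_module R S A by fact
  interpret C: two_sided_module R S C by fact
  interpret \<phi>: group_hom "add_monoid A" "add_monoid C" \<phi>
    using \<phi> by (simp add: group_hom_def group_hom_axioms_def A.a_group C.a_group bimodule_hom_iff)
  interpret \<psi>: group_hom "add_monoid C" "add_monoid A" \<psi>
    using \<psi> by (simp add: group_hom_def group_hom_axioms_def A.a_group C.a_group bimodule_hom_iff)
  note \<phi>_act = \<phi>[unfolded bimodule_hom_iff, THEN conjunct2, THEN conjunct1, rule_format]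
    \<phi>[unfolded bimodule_hom_iff, THEN conjunct2, THEN conjunct2, rule_format]
  note \<psi>_act = \<psi>[unfolded bimodule_hom_iff, THEN conjunct2, THEN conjunct1, rule_format]
    \<psi>[unfolded bimodule_hom_iff, THEN conjunct2, THEN conjunct2, rule_format]
  have \<phi>_closed: "\<phi> a \<in> carrier C" if "a \<in> carrier A" for a
    using \<phi>.hom_closed that by simp
  have \<psi>_closed: "\<psi> v \<in> carrier A" if "v \<in> carrier C" for v
    using \<psi>.hom_closed that by simp
  have \<psi>_add: "\<psi> (v \<oplus>\<^bsub>C\<^esub> w) = \<psi> v \<oplus>\<^bsub>A\<^esub> \<psi> w" if "v \<in> carrier C" "w \<in> carrier C" for v w
    using \<psi>.hom_mult that by simp
  have \<psi>_minus: "\<psi> (\<ominus>\<^bsub>C\<^esub> v) = \<ominus>\<^bsub>A\<^esub> \<psi> v" if "v \<in> carrier C" for v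
    using \<psi>.hom_inv that by (simp add: a_inv_def)
  let ?P = "\<phi> ` carrier A" and ?Q = "kernel (add_monoid C) (add_monoid A) \<psi>"
  have "sub_bimodule R S ?P C"
    unfolding sub_bimodule_def additive_subgroup_def
    using \<phi>.img_is_subgroup
    by (auto simp: \<phi>_act[symmetric] A.smult_closed A.rsmult_closed)
  moreover have "sub_bimodule R S ?Q C"
    unfolding sub_bimodule_def additive_subgroup_def
    using \<psi>.subgroup_kernel
    by (auto simp: kernel_def \<psi>_act C.smult_closed C.rsmult_closed A.smult_zero A.rsmult_zero)
  moreover have "?P \<inter> ?Q = {\<zero>\<^bsub>C\<^esub>}"
  proof -
    have zero: "\<phi> \<zero>\<^bsub>A\<^esub> = \<zero>\<^bsub>C\<^esub>" "\<psi> \<zero>\<^bsub>C\<^esub> = \<zero>\<^bsub>A\<^esub>"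
      using \<phi>.hom_one \<psi>.hom_one by simp_all
    have "\<zero>\<^bsub>C\<^esub> \<in> ?P"
      using A.zero_closed zero(1) by (metis imageI)
    moreover have "\<phi> a = \<zero>\<^bsub>C\<^esub>" if "a \<in> carrier A" "\<phi> a \<in> ?Q" for a
      using that retract[OF that(1)] zero by (simp add: kernel_def)
    ultimately show ?thesis
      using zero by (auto simp: kernel_def)
  qed
  moreover have "?P <+>\<^bsub>C\<^esub> ?Q = carrier C"
  proof (intro equalityI subsetI)
    fix v assume v: "v \<in> carrier C"
    have "v = \<phi> (\<psi> v) \<oplus>\<^bsub>C\<^esub> (v \<oplus>\<^bsub>C\<^esub> \<ominus>\<^bsub>C\<^esub> \<phi> (\<psi> v))"
      using v by (simp add: \<phi>_closed \<psi>_closed C.r_neg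
          C.a_lcomm[of "\<phi> (\<psi> v)" v "\<ominus>\<^bsub>C\<^esub> \<phi> (\<psi> v)"])
    moreover have "v \<oplus>\<^bsub>C\<^esub> \<ominus>\<^bsub>C\<^esub> \<phi> (\<psi> v) \<in> ?Q"
      using v by (simp add: kernel_def \<psi>_add \<psi>_minus \<phi>_closed \<psi>_closed retract A.r_neg)
    ultimately show "v \<in> ?P <+>\<^bsub>C\<^esub> ?Q"
      unfolding set_add_def' using \<psi>_closed[OF v] by blast
  qed (auto simp: set_add_def' kernel_def \<phi>_closed)
  ultimately have "direct_summand R S ?P C"
    unfolding direct_summand_def by blast
  moreover have "\<phi> \<in> bimodule_iso R S A (C\<lparr>carrier := ?P\<rparr>)"
    using \<phi> inj_on_inverseI[of "carrier A" \<psi> \<phi>] retract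
    by (auto simp: bimodule_iso_def bimodule_hom_def bij_betw_def)
  ultimately show ?thesis
    unfolding iso_to_direct_summand_def by blast
qed

section \<open>Summands of finite powers\<close>

lemma bimodule_power_simps:
  "carrier (bimodule_power n B) = (\<Pi>\<^sub>E i\<in>{..<n}. carrier B)"
  "\<zero>\<^bsub>bimodule_power n B\<^esub> = (\<lambda>i\<in>{..<n}. \<zero>\<^bsub>B\<^esub>)"
  "v \<oplus>\<^bsub>bimodule_power n B\<^esub> w = (\<lambda>i\<in>{..<n}. v i \<oplus>\<^bsub>B\<^esub> w i)"
  "r \<odot>\<^bsub>bimodule_power n B\<^esub> v = (\<lambda>i\<in>{..<n}. r \<odot>\<^bsub>B\<^esub> v i)"
  "rsmult (bimodule_power n B) v s = (\<lambda>i\<in>{..<n}. rsmult B (v i) s)"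
  by (simp_all add: bimodule_power_def)

lemma two_sided_module_power:
  assumes "two_sided_module R S B"
  shows "two_sided_module R S (bimodule_power n B)"
proof -
  interpret B: two_sided_module R S B by fact
  have "abelian_group (bimodule_power n B)"
  proof (rule abelian_groupI, goal_cases)
    case (6 v)
    then show ?case
      by (intro bexI[of _ "\<lambda>i\<in>{..<n}. \<ominus>\<^bsub>B\<^esub> v i"])
        (auto simp: bimodule_power_simps PiE_iff B.l_neg intro!: restrict_ext)
  next
    \<comment> \<open>The neutral law is an equality of functions on all of \<open>nat\<close>: the
      sum is \<open>undefined\<close> outside the index set, and extensionality says the same of
      \<open>v\<close>.\<close>
    case (5 v)
    then show ?case
      by (auto simp: bimodule_power_simps PiE_iff extensional_def fun_eq_iff)
  qed (auto simp: bimodule_power_simps PiE_iff B.a_ac intro!: restrict_ext)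
  then show ?thesis
    unfolding two_sided_module_def two_sided_module_axioms_def
    by (auto simp: bimodule_power_simps PiE_iff B.smult_closed B.rsmult_closed B.smult_add B.rsmult_add
        intro!: restrict_ext)
qed

text \<open>A map into a power is a family of coordinate maps, and a map out of it is a sum of maps
  on the coordinates, so a retraction becomes a finite sum of composites. In this form it can be
  tensored with \<open>M\<close> one index at a time.\<close>

lemma iso_to_direct_summand_power_iff:
  assumes A: "two_sided_module R S A" and B: "two_sided_module R S B"
  shows "iso_to_direct_summand R S A (bimodule_power n B) \<longleftrightarrow>
    (\<exists>f g. (\<forall>i<n. f i \<in> bimodule_hom R S A B \<and> g i \<in> bimodule_hom R S B A) \<and>
      (\<forall>a\<in>carrier A. (\<Oplus>\<^bsub>A\<^esub>i\<in>{..<n}. g i (f i a)) = a))"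
proof
  interpret A: two_sided_module R S A by fact
  interpret B: two_sided_module R S B by fact
  let ?C = "bimodule_power n B"
  interpret C: two_sided_module R S ?C
    by (rule two_sided_module_power[OF B])
  {
    assume "iso_to_direct_summand R S A ?C"
    then obtain \<phi> \<psi> where \<phi>: "\<phi> \<in> bimodule_hom R S A ?C" and \<psi>: "\<psi> \<in> bimodule_hom R S ?C A"
      and retract: "\<forall>a\<in>carrier A. \<psi> (\<phi> a) = a"
      using direct_summand_retraction[OF A C.two_sided_module_axioms] by blast
    \<comment> \<open>The inclusion of \<open>B\<close> as coordinate \<open>i\<close>. The maps
      sought are the coordinates of \<open>\<phi>\<close> and the composites of
      \<open>\<psi>\<close> with these inclusions.\<close>
    define e where "e i b = (\<lambda>j\<in>{..<n}. if j = i then b else \<zero>\<^bsub>B\<^esub>)" for i b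
    have e_closed: "e i b \<in> carrier ?C" if "b \<in> carrier B" for i b
      using that by (auto simp: e_def bimodule_power_simps)
    have \<psi>_hom: "\<psi> \<in> add_hom ?C A"
      using \<psi> by (simp add: bimodule_hom_iff)
    have \<phi>_closed: "\<phi> a \<in> carrier ?C" if "a \<in> carrier A" for a
      using \<phi> that by (auto simp: bimodule_hom_def)
    have f: "(\<lambda>a. \<phi> a i) \<in> bimodule_hom R S A B" if "i < n" for i
      using \<phi> that by (auto simp: bimodule_hom_def bimodule_power_simps PiE_iff Pi_iff)
    have g: "(\<lambda>b. \<psi> (e i b)) \<in> bimodule_hom R S B A" if "i < n" for i
    proof -
      have "e i (b \<oplus>\<^bsub>B\<^esub> b') = e i b \<oplus>\<^bsub>?C\<^esub> e i b'" if "b \<in> carrier B" "b' \<in> carrier B" for b b'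
        using that by (auto simp: e_def bimodule_power_simps)
      moreover have "e i (r \<odot>\<^bsub>B\<^esub> b) = r \<odot>\<^bsub>?C\<^esub> e i b" if "r \<in> carrier R" for r b
        using that by (auto simp: e_def bimodule_power_simps B.smult_zero)
      moreover have "e i (rsmult B b s) = rsmult ?C (e i b) s" if "s \<in> carrier S" for s b
        using that by (auto simp: e_def bimodule_power_simps B.rsmult_zero)
      ultimately show ?thesis
        using \<psi> e_closed by (auto simp: bimodule_hom_def)
    qed
    have decomp: "(\<Oplus>\<^bsub>A\<^esub>i\<in>{..<n}. \<psi> (e i (v i))) = \<psi> v" if v: "v \<in> carrier ?C" for v
    proof -
      \<comment> \<open>\<open>w k\<close> is \<open>v\<close> with all coordinates from
        \<open>k\<close> on replaced by zero. Raising \<open>k\<close> by one adds one inclusion, so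
        \<open>\<psi>\<close> splits into the sum by induction inside \<open>A\<close>; at k = n the
        truncation is \<open>v\<close> itself.\<close>
      define w where "w k = (\<lambda>j\<in>{..<n}. if j < k then v j else \<zero>\<^bsub>B\<^esub>)" for k
      have v_closed: "v i \<in> carrier B" if "i < n" for i
        using v that by (auto simp: bimodule_power_simps)
      have w_closed: "w k \<in> carrier ?C" for k
        using v_closed by (auto simp: w_def bimodule_power_simps)
      have "(\<Oplus>\<^bsub>A\<^esub>i\<in>{..<k}. \<psi> (e i (v i))) = \<psi> (w k)" if "k \<le> n" for k
        using that
      proof (induction k)
        case 0
        have "w 0 = \<zero>\<^bsub>?C\<^esub>"
          by (simp add: w_def bimodule_power_simps)
        then show ?case
          using add_hom_zero[OF C.abelian_group_axioms A.abelian_group_axioms \<psi>_hom] by simp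
      next
        case (Suc k)
        have "w (Suc k) = e k (v k) \<oplus>\<^bsub>?C\<^esub> w k"
          using v_closed Suc.prems by (auto simp: w_def e_def bimodule_power_simps less_Suc_eq)
        moreover have "(\<lambda>i. \<psi> (e i (v i))) \<in> {..<k} \<rightarrow> carrier A"
          using Suc.prems v_closed e_closed add_hom_closed[OF \<psi>_hom] by auto
        ultimately show ?case
          using Suc v_closed[of k] e_closed w_closed
          by (simp add: lessThan_Suc add_hom_add[OF \<psi>_hom] add_hom_closed[OF \<psi>_hom])
      qed
      moreover have "w n = v"
        using v by (auto simp: w_def bimodule_power_simps PiE_iff extensional_def)
      ultimately show ?thesis
        by simp
    qed
    have "(\<Oplus>\<^bsub>A\<^esub>i\<in>{..<n}. \<psi> (e i (\<phi> a i))) = a" if "a \<in> carrier A" for a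
      using decomp[OF \<phi>_closed[OF that]] retract that by simp
    then show "\<exists>f g. (\<forall>i<n. f i \<in> bimodule_hom R S A B \<and> g i \<in> bimodule_hom R S B A) \<and>
      (\<forall>a\<in>carrier A. (\<Oplus>\<^bsub>A\<^esub>i\<in>{..<n}. g i (f i a)) = a)"
      using f g by (intro exI[of _ "\<lambda>i a. \<phi> a i"] exI[of _ "\<lambda>i b. \<psi> (e i b)"]) simp
  next
    assume "\<exists>f g. (\<forall>i<n. f i \<in> bimodule_hom R S A B \<and> g i \<in> bimodule_hom R S B A) \<and>
      (\<forall>a\<in>carrier A. (\<Oplus>\<^bsub>A\<^esub>i\<in>{..<n}. g i (f i a)) = a)"
    then obtain f g where f: "\<And>i. i < n \<Longrightarrow> f i \<in> bimodule_hom R S A B"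
      and g: "\<And>i. i < n \<Longrightarrow> g i \<in> bimodule_hom R S B A"
      and sum: "\<And>a. a \<in> carrier A \<Longrightarrow> (\<Oplus>\<^bsub>A\<^esub>i\<in>{..<n}. g i (f i a)) = a"
      by blast
    have g_hom: "g i \<in> add_hom B A" if "i < n" for i
      using g[OF that] by (simp add: bimodule_hom_iff)
    have f_hom: "f i \<in> add_hom A B" if "i < n" for i
      using f[OF that] by (simp add: bimodule_hom_iff)
    have f_act: "f i (r \<odot>\<^bsub>A\<^esub> a) = r \<odot>\<^bsub>B\<^esub> f i a" if "i < n" "r \<in> carrier R" "a \<in> carrier A" for i r a
      using f that by (simp add: bimodule_hom_iff)
    have f_ract: "f i (rsmult A a s) = rsmult B (f i a) s" if "i < n" "s \<in> carrier S" "a \<in> carrier A" for i s a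
      using f that by (simp add: bimodule_hom_iff)
    have g_act: "g i (r \<odot>\<^bsub>B\<^esub> b) = r \<odot>\<^bsub>A\<^esub> g i b" if "i < n" "r \<in> carrier R" "b \<in> carrier B" for i r b
      using g that by (simp add: bimodule_hom_iff)
    have g_ract: "g i (rsmult B b s) = rsmult A (g i b) s" if "i < n" "s \<in> carrier S" "b \<in> carrier B" for i s b
      using g that by (simp add: bimodule_hom_iff)
    \<comment> \<open>Conversely, the \<open>f i\<close> are bundled into one map to the power and
      the \<open>g i\<close> are added up on it; the composite is then the assumed sum.\<close>
    define \<phi> where "\<phi> a = (\<lambda>i\<in>{..<n}. f i a)" for a
    define \<psi> where "\<psi> v = (\<Oplus>\<^bsub>A\<^esub>i\<in>{..<n}. g i (v i))" for v
    have gv: "(\<lambda>i. g i (v i)) \<in> {..<n} \<rightarrow> carrier A" if "v \<in> carrier ?C" for v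
      using that add_hom_closed[OF g_hom] by (auto simp: bimodule_power_simps)
    have v_closed: "v i \<in> carrier B" if "v \<in> carrier ?C" "i < n" for v i
      using that by (auto simp: bimodule_power_simps)
    have "\<phi> \<in> bimodule_hom R S A ?C"
      unfolding bimodule_hom_def
      by (auto simp: \<phi>_def bimodule_power_simps add_hom_closed[OF f_hom] add_hom_add[OF f_hom] f_act f_ract
          intro!: restrict_ext restrict_PiE)
    moreover have "\<psi> \<in> bimodule_hom R S ?C A"
      unfolding bimodule_hom_def
    proof safe
      fix v assume v: "v \<in> carrier ?C"
      show "\<psi> v \<in> carrier A"
        unfolding \<psi>_def using gv[OF v] by simp
      fix w assume w: "w \<in> carrier ?C"
      have "\<psi> (v \<oplus>\<^bsub>?C\<^esub> w) = (\<Oplus>\<^bsub>A\<^esub>i\<in>{..<n}. g i (v i) \<oplus>\<^bsub>A\<^esub> g i (w i))"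
        unfolding \<psi>_def using gv[OF v] gv[OF w] v_closed[OF v] v_closed[OF w]
        by (intro A.finsum_cong') (auto simp: bimodule_power_simps add_hom_add[OF g_hom] add_hom_closed[OF g_hom])
      then show "\<psi> (v \<oplus>\<^bsub>?C\<^esub> w) = \<psi> v \<oplus>\<^bsub>A\<^esub> \<psi> w"
        unfolding \<psi>_def using A.finsum_addf[OF gv[OF v] gv[OF w]] by simp
    next
      fix r v assume r: "r \<in> carrier R" and v: "v \<in> carrier ?C"
      have "\<psi> (r \<odot>\<^bsub>?C\<^esub> v) = (\<Oplus>\<^bsub>A\<^esub>i\<in>{..<n}. r \<odot>\<^bsub>A\<^esub> g i (v i))"
        unfolding \<psi>_def using r v_closed[OF v] gv[OF v]
        by (intro A.finsum_cong') (auto simp: bimodule_power_simps g_act A.smult_closed Pi_iff)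
      then show "\<psi> (r \<odot>\<^bsub>?C\<^esub> v) = r \<odot>\<^bsub>A\<^esub> \<psi> v"
        unfolding \<psi>_def
        using add_hom_finsum[OF A.abelian_group_axioms A.abelian_group_axioms A.smult_hom[OF r] gv[OF v]] by simp
    next
      fix v s assume s: "s \<in> carrier S" and v: "v \<in> carrier ?C"
      have "\<psi> (rsmult ?C v s) = (\<Oplus>\<^bsub>A\<^esub>i\<in>{..<n}. rsmult A (g i (v i)) s)"
        unfolding \<psi>_def using s v_closed[OF v] gv[OF v]
        by (intro A.finsum_cong') (auto simp: bimodule_power_simps g_ract A.rsmult_closed Pi_iff)
      then show "\<psi> (rsmult ?C v s) = rsmult A (\<psi> v) s"
        unfolding \<psi>_def
        using add_hom_finsum[OF A.abelian_group_axioms A.abelian_group_axioms A.rsmult_hom[OF s] gv[OF v]] by simp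
    qed
    moreover have "\<psi> (\<phi> a) = a" if "a \<in> carrier A" for a
    proof -
      have "\<psi> (\<phi> a) = (\<Oplus>\<^bsub>A\<^esub>i\<in>{..<n}. g i (f i a))"
        unfolding \<psi>_def \<phi>_def using that
        by (intro A.finsum_cong') (auto simp: add_hom_closed[OF f_hom] add_hom_closed[OF g_hom])
      then show ?thesis
        using sum[OF that] by simp
    qed
    ultimately show "iso_to_direct_summand R S A ?C"
      by (rule retraction_direct_summand[OF A C.two_sided_module_axioms])
  }
qed

section \<open>The tensor square of a ring extension\<close>

lemma restricted_bimodule_simps [simp]:
  "carrier (restricted_bimodule f g M) = carrier M"
  "a \<oplus>\<^bsub>restricted_bimodule f g M\<^esub> b = a \<oplus>\<^bsub>M\<^esub> b"
  "\<zero>\<^bsub>restricted_bimodule f g M\<^esub> = \<zero>\<^bsub>M\<^esub>"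
  "r \<odot>\<^bsub>restricted_bimodule f g M\<^esub> a = f r \<otimes>\<^bsub>M\<^esub> a"
  "rsmult (restricted_bimodule f g M) a s = a \<otimes>\<^bsub>M\<^esub> g s"
  by (simp_all add: restricted_bimodule_def)

lemma add_hom_restricted_bimodule [simp]:
  "add_hom (restricted_bimodule f g M) C = add_hom M C"
  "add_hom C (restricted_bimodule f g M) = add_hom C M"
  by (simp_all add: hom_def)

lemma abelian_group_restricted_bimodule:
  assumes "ring M"
  shows "abelian_group (restricted_bimodule f g M)"
proof -
  interpret ring M by fact
  show ?thesis
    by (rule abelian_groupI) (auto simp: a_ac intro: l_neg)
qed

lemma two_sided_module_restricted:
  assumes "ring M" "\<And>r. r \<in> carrier R \<Longrightarrow> f r \<in> carrier M" "\<And>s. s \<in> carrier S \<Longrightarrow> g s \<in> carrier M"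
  shows "two_sided_module R S (restricted_bimodule f g M)"
proof -
  interpret ring M by fact
  show ?thesis
    using abelian_group_restricted_bimodule[OF assms(1)] assms(2,3)
    by (simp add: two_sided_module_def two_sided_module_axioms_def l_distr r_distr)
qed

text \<open>Additivity in the substituted map rather than in the formal sum. The second factor of
  the \<open>E\<close>-product sits inside such a map, so its additivity comes from here.\<close>

lemma frag_extend_fun_add: "frag_extend (\<lambda>z. f z + g z) u = frag_extend f u + frag_extend g u"
  using subset_UNIV by (induction u rule: frag_induction) (auto simp: frag_extend_diff)

context balanced_tensor
begin

lemma frag_extend_tensor_free:
  assumes u: "u \<in> carrier (tensor_free A B)"
    and f: "\<And>a b. a \<in> carrier A \<Longrightarrow> b \<in> carrier B \<Longrightarrow> f (a, b) \<in> carrier (tensor_free A B)"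
  shows "frag_extend f u \<in> carrier (tensor_free A B)"
proof -
  have "(\<Union>z\<in>Poly_Mapping.keys u. Poly_Mapping.keys (f z)) \<subseteq> carrier A \<times> carrier B"
  proof (rule UN_least)
    fix z assume "z \<in> Poly_Mapping.keys u"
    then have "z \<in> carrier A \<times> carrier B"
      using u unfolding carrier_tensor_free by blast
    then show "Poly_Mapping.keys (f z) \<subseteq> carrier A \<times> carrier B"
      using f[of "fst z" "snd z"] unfolding carrier_tensor_free by auto
  qed
  then show ?thesis
    using keys_frag_extend[of f u] unfolding carrier_tensor_free by blast
qed

text \<open>Both outer actions and right \<open>E\<close>-multiplication by a pure tensor have this
  shape: every pair is replaced by a formal sum and classes are taken. The union in the last clause
  is the one by which the actions are defined.\<close>

lemma tensor_universal_frag_extend: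
  assumes closed: "\<And>a b. a \<in> carrier A \<Longrightarrow> b \<in> carrier B \<Longrightarrow> f (a, b) \<in> carrier (tensor_free A B)"
    and add_left: "\<And>a a' b. a \<in> carrier A \<Longrightarrow> a' \<in> carrier A \<Longrightarrow> b \<in> carrier B \<Longrightarrow>
      tensor_class S A B (f (a \<oplus>\<^bsub>A\<^esub> a', b)) =
      tensor_class S A B (f (a, b)) \<oplus>\<^bsub>tensor_product S A B\<^esub> tensor_class S A B (f (a', b))"
    and add_right: "\<And>a b b'. a \<in> carrier A \<Longrightarrow> b \<in> carrier B \<Longrightarrow> b' \<in> carrier B \<Longrightarrow>
      tensor_class S A B (f (a, b \<oplus>\<^bsub>B\<^esub> b')) =
      tensor_class S A B (f (a, b)) \<oplus>\<^bsub>tensor_product S A B\<^esub> tensor_class S A B (f (a, b'))"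
    and balanced: "\<And>a s b. a \<in> carrier A \<Longrightarrow> s \<in> carrier S \<Longrightarrow> b \<in> carrier B \<Longrightarrow>
      tensor_class S A B (f (rsmult A a s, b)) = tensor_class S A B (f (a, s \<odot>\<^bsub>B\<^esub> b))"
  shows "\<exists>H. H \<in> add_hom T T \<and>
    (\<forall>u\<in>carrier (tensor_free A B). H (tensor_class S A B u) = tensor_class S A B (frag_extend f u)) \<and>
    (\<forall>X\<in>carrier T. (\<Union>u\<in>X. tensor_class S A B (frag_extend f u)) = H X)"
proof -
  have "\<exists>H. H \<in> add_hom T T \<and>
    (\<forall>u\<in>carrier (tensor_free A B). H (tensor_class S A B u) = tensor_class S A B (frag_extend f u)) \<and>
    (\<forall>X\<in>carrier T. X \<noteq> {} \<and> (\<forall>u\<in>X. tensor_class S A B (frag_extend f u) = H X))"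
    by (rule tensor_universal[OF abelian_group_T])
      (simp_all add: tensor_class_closed frag_extend_tensor_free closed tensor_class_add frag_extend_add
        add_left add_right balanced)
  then obtain H where H: "H \<in> add_hom T T"
    "\<forall>u\<in>carrier (tensor_free A B). H (tensor_class S A B u) = tensor_class S A B (frag_extend f u)"
    "\<forall>X\<in>carrier T. X \<noteq> {} \<and> (\<forall>u\<in>X. tensor_class S A B (frag_extend f u) = H X)"
    by (elim exE conjE) (rule that)
  have "(\<Union>u\<in>X. tensor_class S A B (frag_extend f u)) = H X" if "X \<in> carrier T" for X
    using bspec[OF H(3) that] by (intro UN_eq_on_coset) simp_all
  then show ?thesis
    by (intro exI[of _ H] conjI ballI H(1) bspec[OF H(2)])
qed

end

text \<open>Kept free of Frobenius data because it is used twice: for \<open>\<iota>\<close> from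
  \<open>N\<close> to \<open>M\<close>, and for \<open>\<iota>1\<close> from \<open>M\<close> to
  \<open>M1\<close>, whose tensor square is the module to be split in the theorem.\<close>

locale ring_extension = ring_hom_ring N M \<iota>
  for N :: "('n, 'c) ring_scheme" (structure) and M :: "('m, 'd) ring_scheme" (structure) and \<iota>
begin

sublocale tensor: balanced_tensor N "restricted_bimodule id \<iota> M" "restricted_bimodule \<iota> id M"
  by (simp add: balanced_tensor_def balanced_tensor_axioms_def abelian_group_restricted_bimodule S.ring_axioms)

abbreviation pure (infixl "\<boxtimes>" 72) where
  "a \<boxtimes> b \<equiv> ext_pure_tensor N M \<iota> a b"

abbreviation "T \<equiv> ext_tensor N M \<iota>"

lemmas tensor_defs = ext_tensor_def ext_pure_tensor_def

sublocale T: abelian_group "ext_tensor N M \<iota>"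
  unfolding ext_tensor_def by (rule tensor.abelian_group_T)

lemma pure_closed: "a \<in> carrier M \<Longrightarrow> b \<in> carrier M \<Longrightarrow> a \<boxtimes> b \<in> carrier T"
  using tensor.pure_closed[of a b] unfolding tensor_defs by simp

lemma pure_add_left:
  "a \<in> carrier M \<Longrightarrow> a' \<in> carrier M \<Longrightarrow> b \<in> carrier M \<Longrightarrow> (a \<oplus>\<^bsub>M\<^esub> a') \<boxtimes> b = a \<boxtimes> b \<oplus>\<^bsub>T\<^esub> a' \<boxtimes> b"
  using tensor.pure_add_left[of a a' b] unfolding tensor_defs by simp

lemma pure_add_right:
  "a \<in> carrier M \<Longrightarrow> b \<in> carrier M \<Longrightarrow> b' \<in> carrier M \<Longrightarrow> a \<boxtimes> (b \<oplus>\<^bsub>M\<^esub> b') = a \<boxtimes> b \<oplus>\<^bsub>T\<^esub> a \<boxtimes> b'"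
  using tensor.pure_add_right[of a b b'] unfolding tensor_defs by simp

lemma pure_left_hom: "b \<in> carrier M \<Longrightarrow> (\<lambda>a. a \<boxtimes> b) \<in> add_hom M T"
  by (rule add_homI) (simp_all add: pure_closed pure_add_left)

lemma pure_right_hom: "a \<in> carrier M \<Longrightarrow> (\<lambda>b. a \<boxtimes> b) \<in> add_hom M T"
  by (rule add_homI) (simp_all add: pure_closed pure_add_right)

lemma pure_balanced:
  "a \<in> carrier M \<Longrightarrow> n \<in> carrier N \<Longrightarrow> b \<in> carrier M \<Longrightarrow> (a \<otimes>\<^bsub>M\<^esub> \<iota> n) \<boxtimes> b = a \<boxtimes> (\<iota> n \<otimes>\<^bsub>M\<^esub> b)"
  using tensor.pure_balanced[of a n b] unfolding tensor_defs by simp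

lemma tensor_hom_eqI:
  assumes "g \<in> add_hom T C" "h \<in> add_hom T C" "X \<in> carrier T"
    and "\<And>a b. a \<in> carrier M \<Longrightarrow> b \<in> carrier M \<Longrightarrow> g (a \<boxtimes> b) = h (a \<boxtimes> b)"
  shows "g X = h X"
  using assms(4) unfolding tensor_defs
  by (intro tensor.tensor_hom_eqI[OF assms(1-3)[unfolded tensor_defs]]) simp

lemma tensor_lift:
  assumes "abelian_group C"
    and "\<And>a b. a \<in> carrier M \<Longrightarrow> b \<in> carrier M \<Longrightarrow> \<phi> a b \<in> carrier C"
    and "\<And>a a' b. a \<in> carrier M \<Longrightarrow> a' \<in> carrier M \<Longrightarrow> b \<in> carrier M \<Longrightarrow>
      \<phi> (a \<oplus>\<^bsub>M\<^esub> a') b = \<phi> a b \<oplus>\<^bsub>C\<^esub> \<phi> a' b"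
    and "\<And>a b b'. a \<in> carrier M \<Longrightarrow> b \<in> carrier M \<Longrightarrow> b' \<in> carrier M \<Longrightarrow>
      \<phi> a (b \<oplus>\<^bsub>M\<^esub> b') = \<phi> a b \<oplus>\<^bsub>C\<^esub> \<phi> a b'"
    and "\<And>a n b. a \<in> carrier M \<Longrightarrow> n \<in> carrier N \<Longrightarrow> b \<in> carrier M \<Longrightarrow>
      \<phi> (a \<otimes>\<^bsub>M\<^esub> \<iota> n) b = \<phi> a (\<iota> n \<otimes>\<^bsub>M\<^esub> b)"
  shows "\<exists>H. H \<in> add_hom T C \<and> (\<forall>a\<in>carrier M. \<forall>b\<in>carrier M. H (a \<boxtimes> b) = \<phi> a b)"
  using tensor.tensor_lift[OF assms(1), of \<phi>, unfolded restricted_bimodule_simps, OF assms(2-5)]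
  unfolding tensor_defs by simp

text \<open>Left multiplication of the first factor commutes with the right action of
  \<open>N\<close> on it, by associativity, so it descends. The witness \<open>H\<close> ties the
  union over representatives to its values on pure tensors.\<close>

lemma smult_extends:
  assumes r: "r \<in> carrier M"
  shows "\<exists>H\<in>add_hom T T. (\<forall>X\<in>carrier T. r \<odot>\<^bsub>T\<^esub> X = H X) \<and>
    (\<forall>a\<in>carrier M. \<forall>b\<in>carrier M. H (a \<boxtimes> b) = (r \<otimes>\<^bsub>M\<^esub> a) \<boxtimes> b)"
proof -
  let ?A = "restricted_bimodule id \<iota> M" and ?B = "restricted_bimodule \<iota> id M"
  let ?f = "\<lambda>(a, b). frag_of (r \<otimes>\<^bsub>M\<^esub> a, b)"
  have "\<exists>H. H \<in> add_hom tensor.T tensor.T \<and>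
    (\<forall>u\<in>carrier (tensor_free ?A ?B). H (tensor_class N ?A ?B u) = tensor_class N ?A ?B (frag_extend ?f u)) \<and>
    (\<forall>X\<in>carrier tensor.T. (\<Union>u\<in>X. tensor_class N ?A ?B (frag_extend ?f u)) = H X)"
  proof (rule tensor.tensor_universal_frag_extend, goal_cases)
    case (1 a b)
    then show ?case
      using r by (simp add: tensor.frag_of_tensor_free)
  next
    case (2 a a' b)
    then show ?case
      using r tensor.pure_add_left[of "r \<otimes>\<^bsub>M\<^esub> a" "r \<otimes>\<^bsub>M\<^esub> a'" b]
      by (simp add: pure_tensor_def S.r_distr)
  next
    case (3 a b b')
    then show ?case
      using r tensor.pure_add_right[of "r \<otimes>\<^bsub>M\<^esub> a" b b'] by (simp add: pure_tensor_def)
  next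
    case (4 a n b)
    then show ?case
      using r tensor.pure_balanced[of "r \<otimes>\<^bsub>M\<^esub> a" n b] by (simp add: pure_tensor_def S.m_assoc)
  qed
  then obtain H where H: "H \<in> add_hom tensor.T tensor.T"
    "\<forall>u\<in>carrier (tensor_free ?A ?B). H (tensor_class N ?A ?B u) = tensor_class N ?A ?B (frag_extend ?f u)"
    "\<forall>X\<in>carrier tensor.T. (\<Union>u\<in>X. tensor_class N ?A ?B (frag_extend ?f u)) = H X"
    by (elim exE conjE) (rule that)
  have "r \<odot>\<^bsub>T\<^esub> X = H X" if "X \<in> carrier T" for X
    using H(3)[THEN bspec, of X] that by (simp add: ext_tensor_def tensor_product_def Let_def)
  moreover have "H (a \<boxtimes> b) = (r \<otimes>\<^bsub>M\<^esub> a) \<boxtimes> b" if "a \<in> carrier M" "b \<in> carrier M" for a b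
    using H(2)[THEN bspec, OF tensor.frag_of_tensor_free, of a b] that
    by (simp add: ext_pure_tensor_def pure_tensor_def)
  ultimately show ?thesis
    using H(1)[folded ext_tensor_def] by (intro bexI[of _ H]) simp_all
qed

lemma rsmult_extends:
  assumes r: "r \<in> carrier M"
  shows "\<exists>H\<in>add_hom T T. (\<forall>X\<in>carrier T. rsmult T X r = H X) \<and>
    (\<forall>a\<in>carrier M. \<forall>b\<in>carrier M. H (a \<boxtimes> b) = a \<boxtimes> (b \<otimes>\<^bsub>M\<^esub> r))"
proof -
  let ?A = "restricted_bimodule id \<iota> M" and ?B = "restricted_bimodule \<iota> id M"
  let ?f = "\<lambda>(a, b). frag_of (a, b \<otimes>\<^bsub>M\<^esub> r)"
  have "\<exists>H. H \<in> add_hom tensor.T tensor.T \<and>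
    (\<forall>u\<in>carrier (tensor_free ?A ?B). H (tensor_class N ?A ?B u) = tensor_class N ?A ?B (frag_extend ?f u)) \<and>
    (\<forall>X\<in>carrier tensor.T. (\<Union>u\<in>X. tensor_class N ?A ?B (frag_extend ?f u)) = H X)"
  proof (rule tensor.tensor_universal_frag_extend, goal_cases)
    case (1 a b)
    then show ?case
      using r by (simp add: tensor.frag_of_tensor_free)
  next
    case (2 a a' b)
    then show ?case
      using r tensor.pure_add_left[of a a' "b \<otimes>\<^bsub>M\<^esub> r"]
      by (simp add: pure_tensor_def)
  next
    case (3 a b b')
    then show ?case
      using r tensor.pure_add_right[of a "b \<otimes>\<^bsub>M\<^esub> r" "b' \<otimes>\<^bsub>M\<^esub> r"] by (simp add: pure_tensor_def S.l_distr)
  next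
    case (4 a n b)
    then show ?case
      using r tensor.pure_balanced[of a n "b \<otimes>\<^bsub>M\<^esub> r"] by (simp add: pure_tensor_def S.m_assoc)
  qed
  then obtain H where H: "H \<in> add_hom tensor.T tensor.T"
    "\<forall>u\<in>carrier (tensor_free ?A ?B). H (tensor_class N ?A ?B u) = tensor_class N ?A ?B (frag_extend ?f u)"
    "\<forall>X\<in>carrier tensor.T. (\<Union>u\<in>X. tensor_class N ?A ?B (frag_extend ?f u)) = H X"
    by (elim exE conjE) (rule that)
  have "rsmult T X r = H X" if "X \<in> carrier T" for X
    using H(3)[THEN bspec, of X] that by (simp add: ext_tensor_def tensor_product_def Let_def)
  moreover have "H (a \<boxtimes> b) = a \<boxtimes> (b \<otimes>\<^bsub>M\<^esub> r)" if "a \<in> carrier M" "b \<in> carrier M" for a b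
    using H(2)[THEN bspec, OF tensor.frag_of_tensor_free, of a b] that
    by (simp add: ext_pure_tensor_def pure_tensor_def)
  ultimately show ?thesis
    using H(1)[folded ext_tensor_def] by (intro bexI[of _ H]) simp_all
qed

sublocale T: two_sided_module M M "ext_tensor N M \<iota>"
proof
  fix r X Y assume r: "r \<in> carrier M" and X: "X \<in> carrier T" and Y: "Y \<in> carrier T"
  obtain H where H: "H \<in> add_hom T T" "\<And>X. X \<in> carrier T \<Longrightarrow> r \<odot>\<^bsub>T\<^esub> X = H X"
    using smult_extends[OF r] by (elim bexE conjE) (rule that, assumption, erule bspec)
  show "r \<odot>\<^bsub>T\<^esub> (X \<oplus>\<^bsub>T\<^esub> Y) = r \<odot>\<^bsub>T\<^esub> X \<oplus>\<^bsub>T\<^esub> r \<odot>\<^bsub>T\<^esub> Y" "r \<odot>\<^bsub>T\<^esub> X \<in> carrier T"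
    using X Y by (simp_all add: H(2) add_hom_add[OF H(1)] add_hom_closed[OF H(1)])
  obtain K where K: "K \<in> add_hom T T" "\<And>X. X \<in> carrier T \<Longrightarrow> rsmult T X r = K X"
    using rsmult_extends[OF r] by (elim bexE conjE) (rule that, assumption, erule bspec)
  show "rsmult T (X \<oplus>\<^bsub>T\<^esub> Y) r = rsmult T X r \<oplus>\<^bsub>T\<^esub> rsmult T Y r" "rsmult T X r \<in> carrier T"
    using X Y by (simp_all add: K(2) add_hom_add[OF K(1)] add_hom_closed[OF K(1)])
qed

lemma smult_pure:
  assumes "r \<in> carrier M" "a \<in> carrier M" "b \<in> carrier M"
  shows "r \<odot>\<^bsub>T\<^esub> (a \<boxtimes> b) = (r \<otimes>\<^bsub>M\<^esub> a) \<boxtimes> b"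
proof -
  obtain H where H: "\<forall>X\<in>carrier T. r \<odot>\<^bsub>T\<^esub> X = H X"
    "\<forall>a\<in>carrier M. \<forall>b\<in>carrier M. H (a \<boxtimes> b) = (r \<otimes>\<^bsub>M\<^esub> a) \<boxtimes> b"
    using smult_extends[OF assms(1)] by (elim bexE conjE) (rule that)
  show ?thesis
    using bspec[OF H(1) pure_closed[OF assms(2,3)]] bspec[OF bspec[OF H(2) assms(2)] assms(3)] by simp
qed

lemma rsmult_pure:
  assumes "r \<in> carrier M" "a \<in> carrier M" "b \<in> carrier M"
  shows "rsmult T (a \<boxtimes> b) r = a \<boxtimes> (b \<otimes>\<^bsub>M\<^esub> r)"
proof -
  obtain H where H: "\<forall>X\<in>carrier T. rsmult T X r = H X"
    "\<forall>a\<in>carrier M. \<forall>b\<in>carrier M. H (a \<boxtimes> b) = a \<boxtimes> (b \<otimes>\<^bsub>M\<^esub> r)"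
    using rsmult_extends[OF assms(1)] by (elim bexE conjE) (rule that)
  show ?thesis
    using bspec[OF H(1) pure_closed[OF assms(2,3)]] bspec[OF bspec[OF H(2) assms(2)] assms(3)] by simp
qed

lemma smult_smult:
  assumes "r \<in> carrier M" "s \<in> carrier M" "X \<in> carrier T"
  shows "r \<odot>\<^bsub>T\<^esub> (s \<odot>\<^bsub>T\<^esub> X) = (r \<otimes>\<^bsub>M\<^esub> s) \<odot>\<^bsub>T\<^esub> X"
  by (rule tensor_hom_eqI[OF add_hom_comp[OF T.smult_hom T.smult_hom] T.smult_hom])
    (simp_all add: assms smult_pure pure_closed S.m_assoc)

lemma smult_one: "X \<in> carrier T \<Longrightarrow> \<one>\<^bsub>M\<^esub> \<odot>\<^bsub>T\<^esub> X = X"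
  by (rule tensor_hom_eqI[OF T.smult_hom add_homI]) (simp_all add: smult_pure)

lemma smult_add_left:
  assumes "r \<in> carrier M" "s \<in> carrier M" "X \<in> carrier T"
  shows "(r \<oplus>\<^bsub>M\<^esub> s) \<odot>\<^bsub>T\<^esub> X = r \<odot>\<^bsub>T\<^esub> X \<oplus>\<^bsub>T\<^esub> s \<odot>\<^bsub>T\<^esub> X"
  by (rule tensor_hom_eqI[OF T.smult_hom add_hom_sum[OF T.abelian_group_axioms T.smult_hom T.smult_hom]])
    (simp_all add: assms smult_pure S.l_distr pure_add_left)

lemma rsmult_add_right:
  assumes "r \<in> carrier M" "s \<in> carrier M" "X \<in> carrier T"
  shows "rsmult T X (r \<oplus>\<^bsub>M\<^esub> s) = rsmult T X r \<oplus>\<^bsub>T\<^esub> rsmult T X s"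
  by (rule tensor_hom_eqI[OF T.rsmult_hom add_hom_sum[OF T.abelian_group_axioms T.rsmult_hom T.rsmult_hom]])
    (simp_all add: assms rsmult_pure S.r_distr pure_add_right)

lemma rsmult_rsmult:
  assumes "r \<in> carrier M" "s \<in> carrier M" "X \<in> carrier T"
  shows "rsmult T (rsmult T X r) s = rsmult T X (r \<otimes>\<^bsub>M\<^esub> s)"
  by (rule tensor_hom_eqI[OF add_hom_comp[OF T.rsmult_hom T.rsmult_hom] T.rsmult_hom])
    (simp_all add: assms rsmult_pure pure_closed S.m_assoc)

lemma rsmult_one: "X \<in> carrier T \<Longrightarrow> rsmult T X \<one>\<^bsub>M\<^esub> = X"
  by (rule tensor_hom_eqI[OF T.rsmult_hom add_homI]) (simp_all add: rsmult_pure)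

lemma smult_rsmult:
  assumes "r \<in> carrier M" "s \<in> carrier M" "X \<in> carrier T"
  shows "rsmult T (r \<odot>\<^bsub>T\<^esub> X) s = r \<odot>\<^bsub>T\<^esub> rsmult T X s"
  by (rule tensor_hom_eqI[OF add_hom_comp[OF T.smult_hom T.rsmult_hom] add_hom_comp[OF T.rsmult_hom T.smult_hom]])
    (simp_all add: assms rsmult_pure smult_pure pure_closed)

text \<open>The relations involve the inner actions along \<open>\<iota>\<close> alone, so changing
  the outer maps keeps the quotient group and merely restricts its actions. The tensor squares of
  left and right D2 thus live on the same group \<open>T\<close>.\<close>

lemma tensor_product_restricted:
  fixes f :: "'r \<Rightarrow> 'm" and g :: "'s \<Rightarrow> 'm"
  shows "tensor_product N (restricted_bimodule f \<iota> M) (restricted_bimodule \<iota> g M) =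
    \<lparr>carrier = carrier T, monoid.mult = undefined, one = undefined,
     ring.zero = \<zero>\<^bsub>T\<^esub>, add = (\<oplus>\<^bsub>T\<^esub>),
     smult = (\<lambda>r. smult T (f r)), rsmult = (\<lambda>X s. rsmult T X (g s))\<rparr>"
proof -
  let ?A = "restricted_bimodule id \<iota> M" and ?B = "restricted_bimodule \<iota> id M"
  let ?A' = "restricted_bimodule f \<iota> M" and ?B' = "restricted_bimodule \<iota> g M"
  have F: "tensor_free ?A' ?B' = tensor_free ?A ?B"
    by (simp add: tensor_free_def)
  have R: "tensor_relations N ?A' ?B' = tensor_relations N ?A ?B"
    unfolding tensor_relations_def F by simp
  have C: "tensor_class N ?A' ?B' = tensor_class N ?A ?B"
    unfolding tensor_class_def[abs_def] F R by simp
  show ?thesis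
    by (simp add: tensor_product_def ext_tensor_def Let_def F R C)
qed

lemma two_sided_module_tensor_restricted:
  assumes f: "\<And>r. r \<in> carrier R \<Longrightarrow> f r \<in> carrier M" and g: "\<And>s. s \<in> carrier S \<Longrightarrow> g s \<in> carrier M"
  shows "two_sided_module R S (tensor_product N (restricted_bimodule f \<iota> M) (restricted_bimodule \<iota> g M))"
proof -
  have "abelian_group (tensor_product N (restricted_bimodule f \<iota> M) (restricted_bimodule \<iota> g M))"
    unfolding tensor_product_restricted
  proof (rule abelian_groupI, goal_cases)
    case (6 X)
    then show ?case
      by (intro bexI[of _ "\<ominus>\<^bsub>T\<^esub> X"]) (simp_all add: T.l_neg)
  qed (simp_all add: T.a_ac)
  then show ?thesis
    unfolding two_sided_module_def two_sided_module_axioms_def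
    by (simp add: tensor_product_restricted f g T.smult_closed T.rsmult_closed T.smult_add T.rsmult_add)
qed

lemma map_funcset: "\<iota> \<in> carrier N \<rightarrow> carrier M"
  by simp

text \<open>One statement for both conditions: f = \<iota>, g = id is the case of left D2, and f =
  id, g = \<iota> that of right D2. The right-hand side speaks of \<open>T\<close> with its full
  actions, restricted by where the scalars come from.\<close>

lemma summand_of_power_iff:
  assumes f: "f \<in> carrier R \<rightarrow> carrier M" and g: "g \<in> carrier S \<rightarrow> carrier M"
  shows "iso_to_direct_summand R S
      (tensor_product N (restricted_bimodule f \<iota> M) (restricted_bimodule \<iota> g M))
      (bimodule_power n (restricted_bimodule f g M)) \<longleftrightarrow>
    (\<exists>p q. (\<forall>i<n. p i \<in> add_hom T M \<and> q i \<in> add_hom M T \<and>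
        (\<forall>r\<in>carrier R. \<forall>X\<in>carrier T. p i (f r \<odot>\<^bsub>T\<^esub> X) = f r \<otimes>\<^bsub>M\<^esub> p i X) \<and>
        (\<forall>s\<in>carrier S. \<forall>X\<in>carrier T. p i (rsmult T X (g s)) = p i X \<otimes>\<^bsub>M\<^esub> g s) \<and>
        (\<forall>r\<in>carrier R. \<forall>a\<in>carrier M. q i (f r \<otimes>\<^bsub>M\<^esub> a) = f r \<odot>\<^bsub>T\<^esub> q i a) \<and>
        (\<forall>s\<in>carrier S. \<forall>a\<in>carrier M. q i (a \<otimes>\<^bsub>M\<^esub> g s) = rsmult T (q i a) (g s))) \<and>
      (\<forall>X\<in>carrier T. (\<Oplus>\<^bsub>T\<^esub>i\<in>{..<n}. q i (p i X)) = X))"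
proof -
  let ?L = "tensor_product N (restricted_bimodule f \<iota> M) (restricted_bimodule \<iota> g M)"
  \<comment> \<open>The two records agree in carrier, zero and addition, which is all that a finite
    sum reads.\<close>
  have 1: "finsum ?L h J = finsum T h J" for h :: "nat \<Rightarrow> _" and J
    unfolding finsum_def finprod_def tensor_product_restricted by simp
  have 0: "add_hom ?L C = add_hom T C" "add_hom C ?L = add_hom C T" for C :: "('m, 'd) ring_scheme"
    by (simp_all add: tensor_product_restricted hom_def)
  have act: "r \<odot>\<^bsub>?L\<^esub> X = f r \<odot>\<^bsub>T\<^esub> X" "rsmult ?L X s = rsmult T X (g s)" for r s X
    by (simp_all add: tensor_product_restricted)
  have 4: "carrier ?L = carrier T"
    by (simp add: tensor_product_restricted)
  have 2: "p \<in> bimodule_hom R S ?L (restricted_bimodule f g M) \<longleftrightarrow> p \<in> add_hom T M \<and>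
        (\<forall>r\<in>carrier R. \<forall>X\<in>carrier T. p (f r \<odot>\<^bsub>T\<^esub> X) = f r \<otimes>\<^bsub>M\<^esub> p X) \<and>
        (\<forall>s\<in>carrier S. \<forall>X\<in>carrier T. p (rsmult T X (g s)) = p X \<otimes>\<^bsub>M\<^esub> g s)" for p
    unfolding bimodule_hom_iff 0 add_hom_restricted_bimodule by (simp only: 4 restricted_bimodule_simps act) blast
  have 3: "q \<in> bimodule_hom R S (restricted_bimodule f g M) ?L \<longleftrightarrow> q \<in> add_hom M T \<and>
        (\<forall>r\<in>carrier R. \<forall>a\<in>carrier M. q (f r \<otimes>\<^bsub>M\<^esub> a) = f r \<odot>\<^bsub>T\<^esub> q a) \<and>
        (\<forall>s\<in>carrier S. \<forall>a\<in>carrier M. q (a \<otimes>\<^bsub>M\<^esub> g s) = rsmult T (q a) (g s))" for q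
    unfolding bimodule_hom_iff 0 add_hom_restricted_bimodule by (simp only: 4 restricted_bimodule_simps act) blast
  show ?thesis
    by (subst iso_to_direct_summand_power_iff[OF
        two_sided_module_tensor_restricted[OF funcset_mem[OF f] funcset_mem[OF g]]
        two_sided_module_restricted[OF S.ring_axioms funcset_mem[OF f] funcset_mem[OF g]]])
      (simp_all only: 1 2 3 4 conj_ac)
qed

end

section \<open>The basic construction\<close>

sublocale frobenius_extension \<subseteq> ring_extension N M \<iota>
  by unfold_locales

section \<open>The \<open>E\<close>-multiplication: independence of representatives, biadditivity,
  associativity\<close>

context frobenius_extension
begin

lemma E_closed: "m \<in> carrier M \<Longrightarrow> E m \<in> carrier N"
  and E_add: "m \<in> carrier M \<Longrightarrow> m' \<in> carrier M \<Longrightarrow> E (m \<oplus>\<^bsub>M\<^esub> m') = E m \<oplus>\<^bsub>N\<^esub> E m'"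
  and E_left: "n \<in> carrier N \<Longrightarrow> m \<in> carrier M \<Longrightarrow> E (\<iota> n \<otimes>\<^bsub>M\<^esub> m) = n \<otimes>\<^bsub>N\<^esub> E m"
  and E_right: "n \<in> carrier N \<Longrightarrow> m \<in> carrier M \<Longrightarrow> E (m \<otimes>\<^bsub>M\<^esub> \<iota> n) = E m \<otimes>\<^bsub>N\<^esub> n"
  using E_hom by (auto simp: bimodule_hom_def)

abbreviation tc where
  "tc \<equiv> tensor_class N (restricted_bimodule id \<iota> M) (restricted_bimodule \<iota> id M)"

abbreviation tf where
  "tf \<equiv> tensor_free (restricted_bimodule id \<iota> M) (restricted_bimodule \<iota> id M)"

abbreviation E_mult_infix (infixl "\<star>" 72) where
  "X \<star> Y \<equiv> E_mult N M \<iota> E X Y"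

text \<open>The \<open>E\<close>-product at the level of formal sums, before classes are taken, so
  that the dependence on each representative can be examined separately.\<close>

definition free_mult where
  "free_mult u v = frag_extend (\<lambda>(m, m'). frag_extend (\<lambda>(m'', m''').
     frag_of (m \<otimes>\<^bsub>M\<^esub> \<iota> (E (m' \<otimes>\<^bsub>M\<^esub> m'')), m''')) v) u"

lemma E_mult_free: "X \<star> Y = (\<Union>u\<in>X. \<Union>v\<in>Y. tc (free_mult u v))"
  by (simp add: E_mult_def free_mult_def)

lemma free_mult_frag_of:
  "free_mult u (frag_of (c, d)) = frag_extend (\<lambda>(a, b). frag_of (a \<otimes>\<^bsub>M\<^esub> \<iota> (E (b \<otimes>\<^bsub>M\<^esub> c)), d)) u"
  by (simp add: free_mult_def)

lemma free_mult_closed: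
  assumes "u \<in> carrier tf" "v \<in> carrier tf"
  shows "free_mult u v \<in> carrier tf"
  unfolding free_mult_def
  by (intro tensor.frag_extend_tensor_free[OF assms(1)])
    (auto intro!: tensor.frag_extend_tensor_free[OF assms(2)] tensor.frag_of_tensor_free simp: E_closed)

lemma free_mult_add_right: "free_mult u (v + v') = free_mult u v + free_mult u v'"
  unfolding free_mult_def frag_extend_fun_add[symmetric]
  by (intro frag_extend_eq) (auto simp: frag_extend_add)

text \<open>
  Right multiplication by \<open>c \<otimes> d\<close>. With the second factor pure, only the first one ranges over
  representatives; the general product is then determined by its values on pure second factors.
\<close>

definition pure_mult where
  "pure_mult c d = (SOME H. H \<in> add_hom T T \<and>
     (\<forall>u\<in>carrier tf. H (tc u) = tc (free_mult u (frag_of (c, d)))))"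

text \<open>For fixed \<open>c\<close> and \<open>d\<close> the assignment of a E(b c) \<boxtimes> d
  to (a, b) is balanced because \<open>E\<close> is left \<open>N\<close>-linear: a E(n b c) = (a n)
  E(b c).\<close>

lemma pure_mult:
  assumes c: "c \<in> carrier M" and d: "d \<in> carrier M"
  shows "pure_mult c d \<in> add_hom T T \<and>
    (\<forall>u\<in>carrier tf. pure_mult c d (tc u) = tc (free_mult u (frag_of (c, d))))"
proof -
  let ?f = "\<lambda>(a, b). frag_of (a \<otimes>\<^bsub>M\<^esub> \<iota> (E (b \<otimes>\<^bsub>M\<^esub> c)), d)"
  have "\<exists>H. H \<in> add_hom tensor.T tensor.T \<and>
    (\<forall>u\<in>carrier tf. H (tc u) = tc (frag_extend ?f u)) \<and>
    (\<forall>X\<in>carrier tensor.T. (\<Union>u\<in>X. tc (frag_extend ?f u)) = H X)"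
  proof (rule tensor.tensor_universal_frag_extend, goal_cases)
    case (1 a b)
    then show ?case
      using c d by (simp add: tensor.frag_of_tensor_free E_closed)
  next
    case (2 a a' b)
    then show ?case
      using c d tensor.pure_add_left[of "a \<otimes>\<^bsub>M\<^esub> \<iota> (E (b \<otimes>\<^bsub>M\<^esub> c))" "a' \<otimes>\<^bsub>M\<^esub> \<iota> (E (b \<otimes>\<^bsub>M\<^esub> c))" d]
      by (simp add: pure_tensor_def S.l_distr E_closed)
  next
    case (3 a b b')
    then show ?case
      using c d tensor.pure_add_left[of "a \<otimes>\<^bsub>M\<^esub> \<iota> (E (b \<otimes>\<^bsub>M\<^esub> c))" "a \<otimes>\<^bsub>M\<^esub> \<iota> (E (b' \<otimes>\<^bsub>M\<^esub> c))" d]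
      by (simp add: pure_tensor_def S.l_distr S.r_distr E_closed E_add)
  next
    case (4 a n b)
    then show ?case
      using c d by (simp add: pure_tensor_def S.m_assoc E_closed E_left)
  qed
  then have "\<exists>H. H \<in> add_hom T T \<and> (\<forall>u\<in>carrier tf. H (tc u) = tc (free_mult u (frag_of (c, d))))"
    unfolding ext_tensor_def free_mult_frag_of by (elim exE conjE) (intro exI conjI)
  then show ?thesis
    unfolding pure_mult_def by (rule someI_ex)
qed

lemmas pure_mult_hom = pure_mult[THEN conjunct1]

lemma pure_mult_class:
  "c \<in> carrier M \<Longrightarrow> d \<in> carrier M \<Longrightarrow> u \<in> carrier tf \<Longrightarrow>
    tc (free_mult u (frag_of (c, d))) = pure_mult c d (tc u)"
  using pure_mult[THEN conjunct2, THEN bspec] by simp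

lemma pure_mult_pure:
  assumes "a \<in> carrier M" "b \<in> carrier M" "c \<in> carrier M" "d \<in> carrier M"
  shows "pure_mult c d (a \<boxtimes> b) = (a \<otimes>\<^bsub>M\<^esub> \<iota> (E (b \<otimes>\<^bsub>M\<^esub> c))) \<boxtimes> d"
  using pure_mult_class[OF assms(3,4) tensor.frag_of_tensor_free, of a b] assms
  by (simp add: ext_pure_tensor_def pure_tensor_def free_mult_frag_of)

text \<open>Independence of both representatives, one after the other: with a representative of
  \<open>X\<close> fixed the product descends in \<open>Y\<close>, and the resulting map depends on
  \<open>X\<close> alone because its values on pure tensors do.\<close>

lemma E_mult_extends:
  assumes X: "X \<in> carrier T"
  shows "\<exists>K\<in>add_hom T T. (\<forall>Y\<in>carrier T. X \<star> Y = K Y) \<and>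
    (\<forall>c\<in>carrier M. \<forall>d\<in>carrier M. K (c \<boxtimes> d) = pure_mult c d X)"
proof -
  \<comment> \<open>Here a representative \<open>u\<close> of the first factor is fixed. Each
    condition on the second factor is rewritten as an equation between maps
    \<open>pure_mult c d\<close> at the class of \<open>u\<close>, which is then checked on pure
    tensors.\<close>
  have ex: "\<exists>K. K \<in> add_hom T T \<and> (\<forall>v\<in>carrier tf. K (tc v) = tc (free_mult u v)) \<and>
    (\<forall>Y\<in>carrier T. Y \<noteq> {} \<and> (\<forall>v\<in>Y. tc (free_mult u v) = K Y))"
    if u: "u \<in> carrier tf" for u
  proof -
    have tcu: "tc u \<in> carrier T"
      using tensor.tensor_class_closed[OF u] by (simp add: ext_tensor_def)
    have pm: "tc (free_mult u (frag_of (c, d))) = pure_mult c d (tc u)"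
      if "c \<in> carrier M" "d \<in> carrier M" for c d
      using pure_mult_class[OF that u] .
    have "\<exists>K. K \<in> add_hom tensor.T T \<and> (\<forall>v\<in>carrier tf. K (tc v) = tc (free_mult u v)) \<and>
      (\<forall>Y\<in>carrier tensor.T. Y \<noteq> {} \<and> (\<forall>v\<in>Y. tc (free_mult u v) = K Y))"
    proof (rule tensor.tensor_universal[OF T.abelian_group_axioms], goal_cases)
      case (1 v)
      then show ?case
        using tensor.tensor_class_closed[OF free_mult_closed[OF u]] by (simp add: ext_tensor_def)
    next
      case (2 v v')
      then show ?case
        using tensor.tensor_class_add[OF free_mult_closed[OF u] free_mult_closed[OF u]]
        by (simp add: ext_tensor_def free_mult_add_right)
    next
      case (3 c c' d)
      then have cc: "c \<in> carrier M" "c' \<in> carrier M" "d \<in> carrier M" by simp_all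
      have "pure_mult (c \<oplus>\<^bsub>M\<^esub> c') d (tc u) = pure_mult c d (tc u) \<oplus>\<^bsub>T\<^esub> pure_mult c' d (tc u)"
        by (rule tensor_hom_eqI[OF pure_mult_hom add_hom_sum[OF T.abelian_group_axioms pure_mult_hom pure_mult_hom]])
          (simp_all add: cc tcu pure_mult_pure S.r_distr E_add E_closed pure_add_left)
      then show ?case
        using cc by (simp add: pm)
    next
      case (4 c d d')
      then have cc: "c \<in> carrier M" "d \<in> carrier M" "d' \<in> carrier M" by simp_all
      have "pure_mult c (d \<oplus>\<^bsub>M\<^esub> d') (tc u) = pure_mult c d (tc u) \<oplus>\<^bsub>T\<^esub> pure_mult c d' (tc u)"
        by (rule tensor_hom_eqI[OF pure_mult_hom add_hom_sum[OF T.abelian_group_axioms pure_mult_hom pure_mult_hom]])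
          (simp_all add: cc tcu pure_mult_pure E_closed pure_add_right)
      then show ?case
        using cc by (simp add: pm)
    next
      \<comment> \<open>Balance in the second factor uses right \<open>N\<close>-linearity of
        \<open>E\<close>: a E(b c n) \<boxtimes> d = a E(b c) n \<boxtimes> d, after which n crosses
        the tensor sign.\<close>
      case (5 c n d)
      then have cc: "c \<in> carrier M" "n \<in> carrier N" "d \<in> carrier M" by simp_all
      have "pure_mult (c \<otimes>\<^bsub>M\<^esub> \<iota> n) d (tc u) = pure_mult c (\<iota> n \<otimes>\<^bsub>M\<^esub> d) (tc u)"
      proof (rule tensor_hom_eqI[OF pure_mult_hom pure_mult_hom])
        fix a b assume ab: "a \<in> carrier M" "b \<in> carrier M"
        have "E (b \<otimes>\<^bsub>M\<^esub> (c \<otimes>\<^bsub>M\<^esub> \<iota> n)) = E (b \<otimes>\<^bsub>M\<^esub> c) \<otimes>\<^bsub>N\<^esub> n"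
          using E_right[of n "b \<otimes>\<^bsub>M\<^esub> c"] ab cc by (simp add: S.m_assoc)
        then show "pure_mult (c \<otimes>\<^bsub>M\<^esub> \<iota> n) d (a \<boxtimes> b) = pure_mult c (\<iota> n \<otimes>\<^bsub>M\<^esub> d) (a \<boxtimes> b)"
          using ab cc pure_balanced[of "a \<otimes>\<^bsub>M\<^esub> \<iota> (E (b \<otimes>\<^bsub>M\<^esub> c))" n d]
          by (simp add: pure_mult_pure E_closed S.m_assoc)
      qed (simp_all add: cc tcu)
      then show ?case
        using cc by (simp add: pm)
    qed
    then show ?thesis
      by (simp only: ext_tensor_def)
  qed
  obtain u where u: "u \<in> carrier tf" "X = tc u"
    using tensor.carrier_T_cases X unfolding ext_tensor_def by metis
  obtain K where K: "K \<in> add_hom T T" "\<forall>v\<in>carrier tf. K (tc v) = tc (free_mult u v)"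
    "\<forall>Y\<in>carrier T. Y \<noteq> {} \<and> (\<forall>v\<in>Y. tc (free_mult u v) = K Y)"
    using ex[OF u(1)] by (elim exE conjE) (rule that)
  have K_pure: "K (c \<boxtimes> d) = pure_mult c d X" if "c \<in> carrier M" "d \<in> carrier M" for c d
    using bspec[OF K(2) tensor.frag_of_tensor_free, of c d] pure_mult_class[OF that u(1)] that
    by (simp add: ext_pure_tensor_def pure_tensor_def u(2))
  have "X \<star> Y = K Y" if Y: "Y \<in> carrier T" for Y
    unfolding E_mult_free
  proof (rule UN_eq_on_coset)
    show "X \<noteq> {}"
      unfolding u(2) by (rule tensor.tensor_class_nonempty[OF u(1)])
    fix u' assume "u' \<in> X"
    then have u': "u' \<in> carrier tf" "tc u' = X"
      using tensor.mem_tensor_class[OF u(1), of u'] unfolding u(2) by auto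
    obtain K' where K': "K' \<in> add_hom T T" "\<forall>v\<in>carrier tf. K' (tc v) = tc (free_mult u' v)"
      "\<forall>Y\<in>carrier T. Y \<noteq> {} \<and> (\<forall>v\<in>Y. tc (free_mult u' v) = K' Y)"
      using ex[OF u'(1)] by (elim exE conjE) (rule that)
    have "(\<Union>v\<in>Y. tc (free_mult u' v)) = K' Y"
      using bspec[OF K'(3) Y] by (intro UN_eq_on_coset) simp_all
    \<comment> \<open>Different representatives of \<open>X\<close> give maps with the same values
      on pure tensors, since \<open>pure_mult\<close> reads only the class.\<close>
    also have "K' Y = K Y"
    proof (rule tensor_hom_eqI[OF K'(1) K(1) Y])
      fix c d assume cd: "c \<in> carrier M" "d \<in> carrier M"
      show "K' (c \<boxtimes> d) = K (c \<boxtimes> d)"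
        unfolding K_pure[OF cd]
        using bspec[OF K'(2) tensor.frag_of_tensor_free, of c d] pure_mult_class[OF cd u'(1)] cd
        by (simp add: ext_pure_tensor_def pure_tensor_def u'(2))
    qed
    finally show "(\<Union>v\<in>Y. tc (free_mult u' v)) = K Y" .
  qed
  then show ?thesis
    using K(1) K_pure by (intro bexI[of _ K]) simp_all
qed

lemma E_mult_right_hom:
  assumes X: "X \<in> carrier T"
  shows "(\<lambda>Y. X \<star> Y) \<in> add_hom T T"
proof -
  obtain K where K: "K \<in> add_hom T T" "\<forall>Y\<in>carrier T. X \<star> Y = K Y"
    using E_mult_extends[OF X] by (elim bexE conjE) (rule that)
  show ?thesis
    by (rule add_homI) (simp_all add: K(2) add_hom_closed[OF K(1)] add_hom_add[OF K(1)])
qed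

lemma E_mult_pure_right:
  assumes X: "X \<in> carrier T" and cd: "c \<in> carrier M" "d \<in> carrier M"
  shows "X \<star> (c \<boxtimes> d) = pure_mult c d X"
proof -
  obtain K where K: "\<forall>Y\<in>carrier T. X \<star> Y = K Y"
    "\<forall>c\<in>carrier M. \<forall>d\<in>carrier M. K (c \<boxtimes> d) = pure_mult c d X"
    using E_mult_extends[OF X] by (elim bexE conjE) (rule that)
  show ?thesis
    using bspec[OF K(1) pure_closed[OF cd]] bspec[OF bspec[OF K(2) cd(1)] cd(2)] by simp
qed

lemma E_mult_pure:
  assumes "a \<in> carrier M" "b \<in> carrier M" "c \<in> carrier M" "d \<in> carrier M"
  shows "(a \<boxtimes> b) \<star> (c \<boxtimes> d) = (a \<otimes>\<^bsub>M\<^esub> \<iota> (E (b \<otimes>\<^bsub>M\<^esub> c))) \<boxtimes> d"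
  using assms by (simp add: E_mult_pure_right pure_closed pure_mult_pure)

lemma E_mult_closed: "X \<in> carrier T \<Longrightarrow> Y \<in> carrier T \<Longrightarrow> X \<star> Y \<in> carrier T"
  by (rule add_hom_closed[OF E_mult_right_hom])

lemma E_mult_left_hom:
  assumes Y: "Y \<in> carrier T"
  shows "(\<lambda>X. X \<star> Y) \<in> add_hom T T"
proof (rule add_homI)
  fix X X' assume X: "X \<in> carrier T" "X' \<in> carrier T"
  show "(X \<oplus>\<^bsub>T\<^esub> X') \<star> Y = X \<star> Y \<oplus>\<^bsub>T\<^esub> X' \<star> Y"
    by (rule tensor_hom_eqI[OF E_mult_right_hom
          add_hom_sum[OF T.abelian_group_axioms E_mult_right_hom E_mult_right_hom]])
      (simp_all add: X Y E_mult_pure_right add_hom_add[OF pure_mult_hom])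
qed (simp add: E_mult_closed Y)

text \<open>The factors are reduced to pure tensors one by one, \<open>Z\<close> innermost. There
  both bracketings equal a E(b c) E(d e) \<boxtimes> f, by right \<open>N\<close>-linearity of
  \<open>E\<close>.\<close>

lemma E_mult_assoc:
  assumes "X \<in> carrier T" "Y \<in> carrier T" "Z \<in> carrier T"
  shows "(X \<star> Y) \<star> Z = X \<star> (Y \<star> Z)"
proof -
  have 1: "((a \<boxtimes> b) \<star> (c \<boxtimes> d)) \<star> Z = (a \<boxtimes> b) \<star> ((c \<boxtimes> d) \<star> Z)"
    if abcd: "a \<in> carrier M" "b \<in> carrier M" "c \<in> carrier M" "d \<in> carrier M" for a b c d
  proof (rule tensor_hom_eqI[OF E_mult_right_hom add_hom_comp[OF E_mult_right_hom E_mult_right_hom]])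
    fix e f assume ef: "e \<in> carrier M" "f \<in> carrier M"
    have "E (b \<otimes>\<^bsub>M\<^esub> (c \<otimes>\<^bsub>M\<^esub> \<iota> (E (d \<otimes>\<^bsub>M\<^esub> e)))) = E (b \<otimes>\<^bsub>M\<^esub> c) \<otimes>\<^bsub>N\<^esub> E (d \<otimes>\<^bsub>M\<^esub> e)"
      using E_right[of "E (d \<otimes>\<^bsub>M\<^esub> e)" "b \<otimes>\<^bsub>M\<^esub> c"] abcd ef by (simp add: S.m_assoc E_closed)
    then show "(a \<boxtimes> b) \<star> (c \<boxtimes> d) \<star> (e \<boxtimes> f) = (a \<boxtimes> b) \<star> ((c \<boxtimes> d) \<star> (e \<boxtimes> f))"
      using abcd ef by (simp add: E_mult_pure S.m_assoc E_closed)
  qed (simp_all add: that assms E_mult_closed pure_closed)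
  have 2: "((a \<boxtimes> b) \<star> Y) \<star> Z = (a \<boxtimes> b) \<star> (Y \<star> Z)" if "a \<in> carrier M" "b \<in> carrier M" for a b
    by (rule tensor_hom_eqI[OF add_hom_comp[OF E_mult_right_hom E_mult_left_hom]
          add_hom_comp[OF E_mult_left_hom E_mult_right_hom]])
      (simp_all add: that assms 1 pure_closed)
  show ?thesis
    by (rule tensor_hom_eqI[OF add_hom_comp[OF E_mult_left_hom E_mult_left_hom] E_mult_left_hom])
      (simp_all add: assms 2 E_mult_closed)
qed

lemma E_mult_smult:
  assumes "m \<in> carrier M" "X \<in> carrier T" "Y \<in> carrier T"
  shows "(m \<odot>\<^bsub>T\<^esub> X) \<star> Y = m \<odot>\<^bsub>T\<^esub> (X \<star> Y)"
proof -
  have 1: "(m \<odot>\<^bsub>T\<^esub> (a \<boxtimes> b)) \<star> Y = m \<odot>\<^bsub>T\<^esub> ((a \<boxtimes> b) \<star> Y)"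
    if "a \<in> carrier M" "b \<in> carrier M" for a b
    by (rule tensor_hom_eqI[OF E_mult_right_hom add_hom_comp[OF E_mult_right_hom T.smult_hom]])
      (simp_all add: that assms E_mult_pure smult_pure T.smult_closed pure_closed E_closed S.m_assoc)
  show ?thesis
    by (rule tensor_hom_eqI[OF add_hom_comp[OF T.smult_hom E_mult_left_hom]
          add_hom_comp[OF E_mult_left_hom T.smult_hom]])
      (simp_all add: assms 1)
qed

section \<open>The ring \<open>M1\<close> and its structure map from \<open>M\<close>\<close>

abbreviation "M1 \<equiv> basic_construction N M \<iota> E I x y"

abbreviation "\<iota>1 \<equiv> basic_construction_map N M \<iota> I x y"

lemma M1_simps:
  "carrier M1 = carrier T" "X \<otimes>\<^bsub>M1\<^esub> Y = X \<star> Y" "X \<oplus>\<^bsub>M1\<^esub> Y = X \<oplus>\<^bsub>T\<^esub> Y" "\<zero>\<^bsub>M1\<^esub> = \<zero>\<^bsub>T\<^esub>"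
  "\<one>\<^bsub>M1\<^esub> = (\<Oplus>\<^bsub>T\<^esub>i\<in>I. x i \<boxtimes> y i)"
  by (simp_all add: basic_construction_def Let_def)

lemma xy_closed: "i \<in> I \<Longrightarrow> x i \<in> carrier M" "i \<in> I \<Longrightarrow> y i \<in> carrier M"
  using x_closed y_closed by auto

lemma pure_xy_closed: "(\<lambda>i. x i \<boxtimes> y i) \<in> I \<rightarrow> carrier T"
  using xy_closed pure_closed by auto

lemma M1_one_closed: "\<one>\<^bsub>M1\<^esub> \<in> carrier T"
  unfolding M1_simps by (rule T.finsum_closed[OF pure_xy_closed])

text \<open>The left action passes through the sum that defines the unit. Additivity and
  multiplicativity of \<open>\<iota>1\<close> are thereby inherited from the left action.\<close>

lemma map_smult:
  assumes m: "m \<in> carrier M"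
  shows "\<iota>1 m = m \<odot>\<^bsub>T\<^esub> \<one>\<^bsub>M1\<^esub>"
  unfolding M1_simps basic_construction_map_def
    add_hom_finsum[OF T.abelian_group_axioms T.abelian_group_axioms T.smult_hom[OF m] pure_xy_closed]
  by (rule T.finsum_cong') (auto simp: smult_pure m xy_closed pure_closed)

text \<open>The left dual basis identity, applied to \<open>c\<close> in the first tensor factor of
  c \<boxtimes> d.\<close>

lemma M1_l_one:
  assumes "X \<in> carrier T"
  shows "\<one>\<^bsub>M1\<^esub> \<star> X = X"
proof (rule tensor_hom_eqI[OF E_mult_right_hom[OF M1_one_closed] add_homI assms])
  fix c d assume cd: "c \<in> carrier M" "d \<in> carrier M"
  have "\<one>\<^bsub>M1\<^esub> \<star> (c \<boxtimes> d) = (\<Oplus>\<^bsub>T\<^esub>i\<in>I. (x i \<boxtimes> y i) \<star> (c \<boxtimes> d))"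
    unfolding M1_simps using cd
    by (intro add_hom_finsum[OF T.abelian_group_axioms T.abelian_group_axioms E_mult_left_hom pure_xy_closed])
      (simp add: pure_closed)
  also have "\<dots> = (\<Oplus>\<^bsub>T\<^esub>i\<in>I. (x i \<otimes>\<^bsub>M\<^esub> \<iota> (E (y i \<otimes>\<^bsub>M\<^esub> c))) \<boxtimes> d)"
    using cd by (intro T.finsum_cong') (auto simp: E_mult_pure xy_closed pure_closed E_closed)
  also have "\<dots> = (\<Oplus>\<^bsub>M\<^esub>i\<in>I. x i \<otimes>\<^bsub>M\<^esub> \<iota> (E (y i \<otimes>\<^bsub>M\<^esub> c))) \<boxtimes> d"
    using cd xy_closed
    by (intro add_hom_finsum[OF S.abelian_group_axioms T.abelian_group_axioms pure_left_hom, symmetric])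
      (auto simp: E_closed)
  finally show "\<one>\<^bsub>M1\<^esub> \<star> (c \<boxtimes> d) = c \<boxtimes> d"
    using dual_bases_left[OF cd(1)] by simp
qed simp_all

text \<open>Since a E(b m x_i) \<boxtimes> y_i = a \<boxtimes> E(b m x_i) y_i, the right dual basis
  identity for b m collapses the sum to a \<boxtimes> b m. Together with
  \<open>E_mult_map_left\<close> this identifies \<open>M1\<close>, restricted along
  \<open>\<iota>1\<close>, with the natural bimodule \<open>T\<close>.\<close>

lemma E_mult_map_right:
  assumes m: "m \<in> carrier M" and X: "X \<in> carrier T"
  shows "X \<star> \<iota>1 m = rsmult T X m"
proof -
  have mxy: "(\<lambda>i. (m \<otimes>\<^bsub>M\<^esub> x i) \<boxtimes> y i) \<in> I \<rightarrow> carrier T"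
    using m xy_closed pure_closed by auto
  then have closed: "\<iota>1 m \<in> carrier T"
    unfolding basic_construction_map_def by (rule T.finsum_closed)
  show ?thesis
  proof (rule tensor_hom_eqI[OF E_mult_left_hom[OF closed] T.rsmult_hom[OF m] X])
    fix a b assume ab: "a \<in> carrier M" "b \<in> carrier M"
    have "(a \<boxtimes> b) \<star> \<iota>1 m = (\<Oplus>\<^bsub>T\<^esub>i\<in>I. (a \<boxtimes> b) \<star> ((m \<otimes>\<^bsub>M\<^esub> x i) \<boxtimes> y i))"
      unfolding basic_construction_map_def using ab
      by (intro add_hom_finsum[OF T.abelian_group_axioms T.abelian_group_axioms E_mult_right_hom mxy])
        (simp add: pure_closed)
    also have "\<dots> = (\<Oplus>\<^bsub>T\<^esub>i\<in>I. a \<boxtimes> (\<iota> (E (b \<otimes>\<^bsub>M\<^esub> m \<otimes>\<^bsub>M\<^esub> x i)) \<otimes>\<^bsub>M\<^esub> y i))"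
      using ab m
      by (intro T.finsum_cong')
        (auto simp: E_mult_pure xy_closed pure_closed E_closed pure_balanced S.m_assoc)
    also have "\<dots> = a \<boxtimes> (\<Oplus>\<^bsub>M\<^esub>i\<in>I. \<iota> (E (b \<otimes>\<^bsub>M\<^esub> m \<otimes>\<^bsub>M\<^esub> x i)) \<otimes>\<^bsub>M\<^esub> y i)"
      using ab m xy_closed
      by (intro add_hom_finsum[OF S.abelian_group_axioms T.abelian_group_axioms pure_right_hom, symmetric])
        (auto simp: E_closed)
    finally show "(a \<boxtimes> b) \<star> \<iota>1 m = rsmult T (a \<boxtimes> b) m"
      using dual_bases_right[of "b \<otimes>\<^bsub>M\<^esub> m"] ab m by (simp add: rsmult_pure)
  qed
qed

lemma map_one: "\<iota>1 \<one>\<^bsub>M\<^esub> = \<one>\<^bsub>M1\<^esub>"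
  by (simp add: map_smult smult_one M1_one_closed)

lemma map_closed: "m \<in> carrier M \<Longrightarrow> \<iota>1 m \<in> carrier T"
  by (simp add: map_smult T.smult_closed M1_one_closed)

lemma E_mult_map_left:
  assumes "m \<in> carrier M" "X \<in> carrier T"
  shows "\<iota>1 m \<star> X = m \<odot>\<^bsub>T\<^esub> X"
  using assms by (simp add: map_smult E_mult_smult M1_one_closed M1_l_one)

text \<open>The instance m = 1 of \<open>E_mult_map_right\<close>: the right unit law rests on the
  right dual basis identity.\<close>

lemma M1_r_one: "X \<in> carrier T \<Longrightarrow> X \<star> \<one>\<^bsub>M1\<^esub> = X"
  using E_mult_map_right[of "\<one>\<^bsub>M\<^esub>" X] by (simp add: map_one rsmult_one)

lemma ring_M1: "ring M1"
proof (rule ringI)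
  show "abelian_group M1"
  proof (rule abelian_groupI, goal_cases)
    case (6 X)
    then show ?case
      by (intro bexI[of _ "\<ominus>\<^bsub>T\<^esub> X"]) (simp_all add: M1_simps T.l_neg)
  qed (simp_all add: M1_simps T.a_ac)
  show "monoid M1"
  proof (rule monoidI, goal_cases)
    case 2
    show ?case
      using M1_one_closed by (simp only: M1_simps(1))
  next
    case (4 X)
    then show ?case
      using M1_l_one by (simp only: M1_simps(1,2))
  next
    case (5 X)
    then show ?case
      using M1_r_one by (simp only: M1_simps(1,2))
  qed (simp_all add: M1_simps(1,2) E_mult_closed E_mult_assoc)
qed (simp_all add: M1_simps(1,2,3) add_hom_add[OF E_mult_left_hom] add_hom_add[OF E_mult_right_hom])

lemma ring_hom_M1: "ring_hom_ring M M1 \<iota>1"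
proof (rule ring_hom_ringI[OF S.ring_axioms ring_M1])
  fix m m' assume mm: "m \<in> carrier M" "m' \<in> carrier M"
  show "\<iota>1 m \<in> carrier M1"
    using map_closed[OF mm(1)] by (simp add: M1_simps(1))
  show "\<iota>1 (m \<oplus>\<^bsub>M\<^esub> m') = \<iota>1 m \<oplus>\<^bsub>M1\<^esub> \<iota>1 m'"
    using mm by (simp add: M1_simps(3) map_smult smult_add_left M1_one_closed)
  show "\<iota>1 (m \<otimes>\<^bsub>M\<^esub> m') = \<iota>1 m \<otimes>\<^bsub>M1\<^esub> \<iota>1 m'"
    unfolding M1_simps(2) E_mult_map_left[OF mm(1) map_closed[OF mm(2)]]
    using mm by (simp add: map_smult smult_smult M1_one_closed)
qed (rule map_one)

sublocale M1: ring_extension M M1 \<iota>1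
  by (simp add: ring_extension_def ring_hom_M1)

end

section \<open>Depth two\<close>

text \<open>Makes the sum of the composites Q_i P_i an additive map, so that it can be compared with
  the identity on pure tensors.\<close>

lemma add_hom_finsum_fun:
  assumes B: "abelian_group B" and f: "\<And>i. i \<in> J \<Longrightarrow> f i \<in> add_hom A B"
  shows "(\<lambda>a. \<Oplus>\<^bsub>B\<^esub>i\<in>J. f i a) \<in> add_hom A B"
proof -
  interpret B: abelian_group B by fact
  have closed: "(\<lambda>i. f i a) \<in> J \<rightarrow> carrier B" if "a \<in> carrier A" for a
    using add_hom_closed[OF f that] by auto
  show ?thesis
  proof (rule add_homI)
    fix a a' assume a: "a \<in> carrier A" "a' \<in> carrier A"
    have "(\<Oplus>\<^bsub>B\<^esub>i\<in>J. f i (a \<oplus>\<^bsub>A\<^esub> a')) = (\<Oplus>\<^bsub>B\<^esub>i\<in>J. f i a \<oplus>\<^bsub>B\<^esub> f i a')"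
      using add_hom_add[OF f a] add_hom_closed[OF f a(1)] add_hom_closed[OF f a(2)]
      by (intro B.finsum_cong') auto
    then show "(\<Oplus>\<^bsub>B\<^esub>i\<in>J. f i (a \<oplus>\<^bsub>A\<^esub> a')) = (\<Oplus>\<^bsub>B\<^esub>i\<in>J. f i a) \<oplus>\<^bsub>B\<^esub> (\<Oplus>\<^bsub>B\<^esub>i\<in>J. f i a')"
      by (simp add: B.finsum_addf closed a)
  qed (simp add: B.finsum_closed closed)
qed

section \<open>The tensor square of \<open>M1\<close> over \<open>M\<close>, and the maps induced on
  it\<close>

context frobenius_extension
begin

abbreviation pure1 (infixl "\<boxtimes>\<^sub>1" 71) where
  "X \<boxtimes>\<^sub>1 Y \<equiv> ext_pure_tensor M M1 \<iota>1 X Y"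

abbreviation "T2 \<equiv> ext_tensor M M1 \<iota>1"

lemma add_hom_M1: "add_hom M1 C = add_hom T C" "add_hom C M1 = add_hom C T"
  by (simp_all add: hom_def M1_simps(1,3))

lemma pure1_closed: "X \<in> carrier T \<Longrightarrow> Y \<in> carrier T \<Longrightarrow> X \<boxtimes>\<^sub>1 Y \<in> carrier T2"
  using M1.pure_closed by (simp add: M1_simps(1))

lemma pure1_left_hom: "Y \<in> carrier T \<Longrightarrow> (\<lambda>X. X \<boxtimes>\<^sub>1 Y) \<in> add_hom T T2"
  by (rule M1.pure_left_hom[unfolded add_hom_M1, unfolded M1_simps(1)])

lemma pure1_right_hom: "X \<in> carrier T \<Longrightarrow> (\<lambda>Y. X \<boxtimes>\<^sub>1 Y) \<in> add_hom T T2"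
  by (rule M1.pure_right_hom[unfolded add_hom_M1, unfolded M1_simps(1)])

text \<open>Multiplication by \<open>\<iota>1 m\<close> in \<open>M1\<close> is the natural action
  of m on either side of \<open>T\<close>, so scalars of \<open>M\<close> cross the outer tensor
  sign in their natural form.\<close>

lemma pure1_balanced:
  assumes "X \<in> carrier T" "m \<in> carrier M" "Y \<in> carrier T"
  shows "rsmult T X m \<boxtimes>\<^sub>1 Y = X \<boxtimes>\<^sub>1 (m \<odot>\<^bsub>T\<^esub> Y)"
  using M1.pure_balanced[of X m Y] assms
  by (simp add: M1_simps(1,2) E_mult_map_left E_mult_map_right)

lemma smult_pure1:
  "Z \<in> carrier T \<Longrightarrow> X \<in> carrier T \<Longrightarrow> Y \<in> carrier T \<Longrightarrow> Z \<odot>\<^bsub>T2\<^esub> (X \<boxtimes>\<^sub>1 Y) = (Z \<star> X) \<boxtimes>\<^sub>1 Y"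
  using M1.smult_pure[of Z X Y] by (simp add: M1_simps(1,2))

lemma rsmult_pure1:
  "Z \<in> carrier T \<Longrightarrow> X \<in> carrier T \<Longrightarrow> Y \<in> carrier T \<Longrightarrow> rsmult T2 (X \<boxtimes>\<^sub>1 Y) Z = X \<boxtimes>\<^sub>1 (Y \<star> Z)"
  using M1.rsmult_pure[of Z X Y] by (simp add: M1_simps(1,2))

lemma smult1_hom: "Z \<in> carrier T \<Longrightarrow> (\<lambda>W. Z \<odot>\<^bsub>T2\<^esub> W) \<in> add_hom T2 T2"
  using M1.T.smult_hom by (simp add: M1_simps(1))

lemma rsmult1_hom: "Z \<in> carrier T \<Longrightarrow> (\<lambda>W. rsmult T2 W Z) \<in> add_hom T2 T2"
  using M1.T.rsmult_hom by (simp add: M1_simps(1))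

text \<open>Additivity in the scalar, so that an element of \<open>M1\<close> acting on a fixed
  tensor may itself be taken to be pure.\<close>

lemma smult1_left_hom: "W \<in> carrier T2 \<Longrightarrow> (\<lambda>Z. Z \<odot>\<^bsub>T2\<^esub> W) \<in> add_hom T T2"
  using M1.smult_add_left M1.T.smult_closed by (intro add_homI) (simp_all add: M1_simps(1,3))

lemma rsmult1_right_hom: "W \<in> carrier T2 \<Longrightarrow> (\<lambda>Z. rsmult T2 W Z) \<in> add_hom T T2"
  using M1.rsmult_add_right M1.T.rsmult_closed by (intro add_homI) (simp_all add: M1_simps(1,3))

lemma T2_hom_eqI:
  assumes "g \<in> add_hom T2 C" "h \<in> add_hom T2 C" "W \<in> carrier T2"
    and "\<And>X Y. X \<in> carrier T \<Longrightarrow> Y \<in> carrier T \<Longrightarrow> g (X \<boxtimes>\<^sub>1 Y) = h (X \<boxtimes>\<^sub>1 Y)"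
  shows "g W = h W"
  using assms(4) by (intro M1.tensor_hom_eqI[OF assms(1-3)]) (simp add: M1_simps(1))

lemma T2_lift:
  assumes "\<And>X Y. X \<in> carrier T \<Longrightarrow> Y \<in> carrier T \<Longrightarrow> \<phi> X Y \<in> carrier T"
    and "\<And>X X' Y. X \<in> carrier T \<Longrightarrow> X' \<in> carrier T \<Longrightarrow> Y \<in> carrier T \<Longrightarrow>
      \<phi> (X \<oplus>\<^bsub>T\<^esub> X') Y = \<phi> X Y \<oplus>\<^bsub>T\<^esub> \<phi> X' Y"
    and "\<And>X Y Y'. X \<in> carrier T \<Longrightarrow> Y \<in> carrier T \<Longrightarrow> Y' \<in> carrier T \<Longrightarrow>
      \<phi> X (Y \<oplus>\<^bsub>T\<^esub> Y') = \<phi> X Y \<oplus>\<^bsub>T\<^esub> \<phi> X Y'"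
    and "\<And>X m Y. X \<in> carrier T \<Longrightarrow> m \<in> carrier M \<Longrightarrow> Y \<in> carrier T \<Longrightarrow>
      \<phi> (rsmult T X m) Y = \<phi> X (m \<odot>\<^bsub>T\<^esub> Y)"
  shows "\<exists>P. P \<in> add_hom T2 T \<and> (\<forall>X\<in>carrier T. \<forall>Y\<in>carrier T. P (X \<boxtimes>\<^sub>1 Y) = \<phi> X Y)"
proof (rule M1.tensor_lift[OF T.abelian_group_axioms, of \<phi>, unfolded M1_simps(1-3)], goal_cases)
  case (4 X m Y)
  then show ?case
    by (simp add: E_mult_map_left E_mult_map_right assms(4))
qed (simp_all add: assms(1-3))

text \<open>Left \<open>M1\<close>-linearity holds because (c \<boxtimes> d) \<star> (a \<boxtimes>
  b) = c E(d a) \<boxtimes> b leaves \<open>b\<close>, and with it the argument of \<open>p\<close>,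
  untouched. Right \<open>M\<close>-linearity is that of \<open>p\<close>.\<close>

lemma left_induced_down:
  assumes p: "p \<in> add_hom T M"
    and p_left: "\<And>n X. n \<in> carrier N \<Longrightarrow> X \<in> carrier T \<Longrightarrow> p (\<iota> n \<odot>\<^bsub>T\<^esub> X) = \<iota> n \<otimes>\<^bsub>M\<^esub> p X"
    and p_right: "\<And>m X. m \<in> carrier M \<Longrightarrow> X \<in> carrier T \<Longrightarrow> p (rsmult T X m) = p X \<otimes>\<^bsub>M\<^esub> m"
  shows "\<exists>P. P \<in> add_hom T2 T \<and>
    (\<forall>a\<in>carrier M. \<forall>b\<in>carrier M. \<forall>Y\<in>carrier T. P ((a \<boxtimes> b) \<boxtimes>\<^sub>1 Y) = a \<boxtimes> p (b \<odot>\<^bsub>T\<^esub> Y)) \<and>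
    (\<forall>Z\<in>carrier T. \<forall>W\<in>carrier T2. P (Z \<odot>\<^bsub>T2\<^esub> W) = Z \<star> P W) \<and>
    (\<forall>m\<in>carrier M. \<forall>W\<in>carrier T2. P (rsmult T2 W (\<iota>1 m)) = P W \<star> \<iota>1 m)"
proof -
  note p_closed = add_hom_closed[OF p] and p_add = add_hom_add[OF p]
  \<comment> \<open>The map is lifted in two stages. For fixed \<open>Y\<close> the inner balance
    over \<open>N\<close> is p (n b Y) = n p (b Y); the resulting maps \<open>H Y\<close> are then
    lifted jointly in both variables.\<close>
  have "\<forall>Y\<in>carrier T. \<exists>H. H \<in> add_hom T T \<and>
    (\<forall>a\<in>carrier M. \<forall>b\<in>carrier M. H (a \<boxtimes> b) = a \<boxtimes> p (b \<odot>\<^bsub>T\<^esub> Y))"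
  proof
    fix Y assume Y: "Y \<in> carrier T"
    show "\<exists>H. H \<in> add_hom T T \<and>
      (\<forall>a\<in>carrier M. \<forall>b\<in>carrier M. H (a \<boxtimes> b) = a \<boxtimes> p (b \<odot>\<^bsub>T\<^esub> Y))"
      by (rule tensor_lift[OF T.abelian_group_axioms])
        (simp_all add: Y T.smult_closed p_closed p_add pure_closed pure_add_left pure_add_right smult_add_left
          pure_balanced smult_smult[symmetric] p_left)
  qed
  then obtain H where "\<forall>Y\<in>carrier T. H Y \<in> add_hom T T \<and>
    (\<forall>a\<in>carrier M. \<forall>b\<in>carrier M. H Y (a \<boxtimes> b) = a \<boxtimes> p (b \<odot>\<^bsub>T\<^esub> Y))"
    by (elim bchoice[THEN exE])
  then have H: "\<And>Y. Y \<in> carrier T \<Longrightarrow> H Y \<in> add_hom T T"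
    and H_pure: "\<And>Y a b. Y \<in> carrier T \<Longrightarrow> a \<in> carrier M \<Longrightarrow> b \<in> carrier M \<Longrightarrow>
      H Y (a \<boxtimes> b) = a \<boxtimes> p (b \<odot>\<^bsub>T\<^esub> Y)"
    by simp_all
  have "\<exists>P. P \<in> add_hom T2 T \<and> (\<forall>X\<in>carrier T. \<forall>Y\<in>carrier T. P (X \<boxtimes>\<^sub>1 Y) = H Y X)"
  proof (rule T2_lift, goal_cases)
    case (3 X Y Y')
    show ?case
      by (rule tensor_hom_eqI[OF H add_hom_sum[OF T.abelian_group_axioms H H]])
        (simp_all add: 3 H_pure T.smult_add T.smult_closed p_add p_closed pure_add_right)
  next
    \<comment> \<open>Balance over \<open>M\<close>: moving m from a \<boxtimes> b m to m Y leaves a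
      \<boxtimes> p (b m Y) unchanged.\<close>
    case (4 X m Y)
    show ?case
      by (rule tensor_hom_eqI[OF add_hom_comp[OF T.rsmult_hom H] H])
        (simp_all add: 4 H_pure rsmult_pure smult_smult T.smult_closed)
  qed (simp_all add: add_hom_closed[OF H] add_hom_add[OF H])
  then obtain P where P: "P \<in> add_hom T2 T"
    and P_pure: "\<forall>X\<in>carrier T. \<forall>Y\<in>carrier T. P (X \<boxtimes>\<^sub>1 Y) = H Y X"
    by (elim exE conjE) (rule that)
  have 1: "H Y (Z \<star> X) = Z \<star> H Y X" if X: "X \<in> carrier T" and Y: "Y \<in> carrier T" and Z: "Z \<in> carrier T" for X Y Z
  proof (rule tensor_hom_eqI[OF add_hom_comp[OF E_mult_right_hom H] add_hom_comp[OF H E_mult_right_hom] X])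
    fix a b assume ab: "a \<in> carrier M" "b \<in> carrier M"
    show "H Y (Z \<star> (a \<boxtimes> b)) = Z \<star> H Y (a \<boxtimes> b)"
      by (rule tensor_hom_eqI[OF add_hom_comp[OF E_mult_left_hom H] E_mult_left_hom Z])
        (simp_all add: ab Y pure_closed H_pure E_mult_pure E_closed p_closed T.smult_closed)
  qed (simp_all add: Y Z)
  have 2: "H (rsmult T Y m) X = rsmult T (H Y X) m"
    if X: "X \<in> carrier T" and Y: "Y \<in> carrier T" and m: "m \<in> carrier M" for X Y m
    by (rule tensor_hom_eqI[OF H add_hom_comp[OF H T.rsmult_hom] X])
      (simp_all add: m Y T.rsmult_closed T.smult_closed H_pure rsmult_pure smult_rsmult[symmetric] p_right p_closed)
  have "P (Z \<odot>\<^bsub>T2\<^esub> W) = Z \<star> P W" if Z: "Z \<in> carrier T" and W: "W \<in> carrier T2" for Z W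
    by (rule T2_hom_eqI[OF add_hom_comp[OF smult1_hom P] add_hom_comp[OF P E_mult_right_hom] W])
      (simp_all add: Z smult_pure1 P_pure E_mult_closed 1)
  moreover have "P (rsmult T2 W (\<iota>1 m)) = P W \<star> \<iota>1 m" if m: "m \<in> carrier M" and W: "W \<in> carrier T2" for m W
    by (rule T2_hom_eqI[OF add_hom_comp[OF rsmult1_hom P] add_hom_comp[OF P E_mult_left_hom] W])
      (simp_all add: m map_closed rsmult_pure1 P_pure E_mult_closed E_mult_map_right 2 add_hom_closed[OF H] T.rsmult_closed)
  moreover have "P ((a \<boxtimes> b) \<boxtimes>\<^sub>1 Y) = a \<boxtimes> p (b \<odot>\<^bsub>T\<^esub> Y)"
    if "a \<in> carrier M" "b \<in> carrier M" "Y \<in> carrier T" for a b Y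
    by (simp add: that P_pure H_pure pure_closed)
  ultimately show ?thesis
    using P by (intro exI[of _ P]) simp
qed

lemma left_induced_up:
  assumes q: "q \<in> add_hom M T"
    and q_left: "\<And>n a. n \<in> carrier N \<Longrightarrow> a \<in> carrier M \<Longrightarrow> q (\<iota> n \<otimes>\<^bsub>M\<^esub> a) = \<iota> n \<odot>\<^bsub>T\<^esub> q a"
    and q_right: "\<And>m a. m \<in> carrier M \<Longrightarrow> a \<in> carrier M \<Longrightarrow> q (a \<otimes>\<^bsub>M\<^esub> m) = rsmult T (q a) m"
  shows "\<exists>Q. Q \<in> add_hom T T2 \<and>
    (\<forall>a\<in>carrier M. \<forall>b\<in>carrier M. Q (a \<boxtimes> b) = (a \<boxtimes> \<one>\<^bsub>M\<^esub>) \<boxtimes>\<^sub>1 q b) \<and>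
    (\<forall>Z\<in>carrier T. \<forall>X\<in>carrier T. Q (Z \<star> X) = Z \<odot>\<^bsub>T2\<^esub> Q X) \<and>
    (\<forall>m\<in>carrier M. \<forall>X\<in>carrier T. Q (X \<star> \<iota>1 m) = rsmult T2 (Q X) (\<iota>1 m))"
proof -
  note q_closed = add_hom_closed[OF q] and q_add = add_hom_add[OF q]
  have "\<exists>Q. Q \<in> add_hom T T2 \<and>
    (\<forall>a\<in>carrier M. \<forall>b\<in>carrier M. Q (a \<boxtimes> b) = (a \<boxtimes> \<one>\<^bsub>M\<^esub>) \<boxtimes>\<^sub>1 q b)"
  proof (rule tensor_lift[OF M1.T.abelian_group_axioms], goal_cases)
    case (4 a n b)
    \<comment> \<open>The scalar n passes through the inner tensor sign and becomes a right action
      on a \<boxtimes> 1; from there it crosses the outer sign and is absorbed by the left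
      \<open>N\<close>-linearity of \<open>q\<close>.\<close>
    have "(a \<otimes>\<^bsub>M\<^esub> \<iota> n) \<boxtimes> \<one>\<^bsub>M\<^esub> = rsmult T (a \<boxtimes> \<one>\<^bsub>M\<^esub>) (\<iota> n)"
      using 4 by (simp add: pure_balanced rsmult_pure)
    then show ?case
      using 4 by (simp add: pure1_balanced q_left q_closed pure_closed)
  qed (simp_all add: pure1_closed pure_closed q_closed q_add pure_add_left
      add_hom_add[OF pure1_left_hom] add_hom_add[OF pure1_right_hom])
  then obtain Q where Q: "Q \<in> add_hom T T2"
    and Q_pure: "\<forall>a\<in>carrier M. \<forall>b\<in>carrier M. Q (a \<boxtimes> b) = (a \<boxtimes> \<one>\<^bsub>M\<^esub>) \<boxtimes>\<^sub>1 q b"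
    by (elim exE conjE) (rule that)
  have "Q (Z \<star> X) = Z \<odot>\<^bsub>T2\<^esub> Q X" if X: "X \<in> carrier T" and Z: "Z \<in> carrier T" for X Z
  proof (rule tensor_hom_eqI[OF add_hom_comp[OF E_mult_right_hom Q] add_hom_comp[OF Q smult1_hom] X])
    fix a b assume ab: "a \<in> carrier M" "b \<in> carrier M"
    show "Q (Z \<star> (a \<boxtimes> b)) = Z \<odot>\<^bsub>T2\<^esub> Q (a \<boxtimes> b)"
      by (rule tensor_hom_eqI[OF add_hom_comp[OF E_mult_left_hom Q] smult1_left_hom Z])
        (simp_all add: ab pure_closed Q_pure E_mult_pure E_closed q_closed pure1_closed smult_pure1)
  qed (simp_all add: Z)
  moreover have "Q (X \<star> \<iota>1 m) = rsmult T2 (Q X) (\<iota>1 m)" if X: "X \<in> carrier T" and m: "m \<in> carrier M" for X m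
    by (rule tensor_hom_eqI[OF add_hom_comp[OF E_mult_left_hom Q] add_hom_comp[OF Q rsmult1_hom] X])
      (simp_all add: m map_closed E_mult_map_right pure_closed rsmult_pure Q_pure rsmult_pure1 q_closed q_right)
  ultimately show ?thesis
    using Q Q_pure by (intro exI[of _ Q]) simp
qed

text \<open>The mirror construction puts the new factor \<open>M\<close> last: \<open>p\<close> acts
  on X c and \<open>d\<close> is carried along. Left \<open>M\<close>-linearity comes from
  \<open>p\<close>, right \<open>M1\<close>-linearity from the product formula.\<close>

lemma right_induced_down:
  assumes p: "p \<in> add_hom T M"
    and p_left: "\<And>m X. m \<in> carrier M \<Longrightarrow> X \<in> carrier T \<Longrightarrow> p (m \<odot>\<^bsub>T\<^esub> X) = m \<otimes>\<^bsub>M\<^esub> p X"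
    and p_right: "\<And>n X. n \<in> carrier N \<Longrightarrow> X \<in> carrier T \<Longrightarrow> p (rsmult T X (\<iota> n)) = p X \<otimes>\<^bsub>M\<^esub> \<iota> n"
  shows "\<exists>P. P \<in> add_hom T2 T \<and>
    (\<forall>X\<in>carrier T. \<forall>c\<in>carrier M. \<forall>d\<in>carrier M. P (X \<boxtimes>\<^sub>1 (c \<boxtimes> d)) = p (rsmult T X c) \<boxtimes> d) \<and>
    (\<forall>m\<in>carrier M. \<forall>W\<in>carrier T2. P (\<iota>1 m \<odot>\<^bsub>T2\<^esub> W) = \<iota>1 m \<star> P W) \<and>
    (\<forall>Z\<in>carrier T. \<forall>W\<in>carrier T2. P (rsmult T2 W Z) = P W \<star> Z)"
proof -
  note p_closed = add_hom_closed[OF p] and p_add = add_hom_add[OF p]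
  have "\<forall>X\<in>carrier T. \<exists>H. H \<in> add_hom T T \<and>
    (\<forall>c\<in>carrier M. \<forall>d\<in>carrier M. H (c \<boxtimes> d) = p (rsmult T X c) \<boxtimes> d)"
  proof
    fix X assume X: "X \<in> carrier T"
    show "\<exists>H. H \<in> add_hom T T \<and>
      (\<forall>c\<in>carrier M. \<forall>d\<in>carrier M. H (c \<boxtimes> d) = p (rsmult T X c) \<boxtimes> d)"
      by (rule tensor_lift[OF T.abelian_group_axioms])
        (simp_all add: X T.rsmult_closed p_closed p_add pure_closed pure_add_left pure_add_right rsmult_add_right
          pure_balanced rsmult_rsmult[symmetric] p_right)
  qed
  then obtain H where "\<forall>X\<in>carrier T. H X \<in> add_hom T T \<and>
    (\<forall>c\<in>carrier M. \<forall>d\<in>carrier M. H X (c \<boxtimes> d) = p (rsmult T X c) \<boxtimes> d)"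
    by (elim bchoice[THEN exE])
  then have H: "\<And>X. X \<in> carrier T \<Longrightarrow> H X \<in> add_hom T T"
    and H_pure: "\<And>X c d. X \<in> carrier T \<Longrightarrow> c \<in> carrier M \<Longrightarrow> d \<in> carrier M \<Longrightarrow>
      H X (c \<boxtimes> d) = p (rsmult T X c) \<boxtimes> d"
    by simp_all
  have "\<exists>P. P \<in> add_hom T2 T \<and> (\<forall>X\<in>carrier T. \<forall>Y\<in>carrier T. P (X \<boxtimes>\<^sub>1 Y) = H X Y)"
  proof (rule T2_lift, goal_cases)
    case (2 X X' Y)
    show ?case
      by (rule tensor_hom_eqI[OF H add_hom_sum[OF T.abelian_group_axioms H H]])
        (simp_all add: 2 H_pure T.rsmult_add T.rsmult_closed p_add p_closed pure_add_left)
  next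
    case (4 X m Y)
    show ?case
      by (rule tensor_hom_eqI[OF H add_hom_comp[OF T.smult_hom H]])
        (simp_all add: 4 H_pure smult_pure rsmult_rsmult T.rsmult_closed)
  qed (simp_all add: add_hom_closed[OF H] add_hom_add[OF H])
  then obtain P where P: "P \<in> add_hom T2 T"
    and P_pure: "\<forall>X\<in>carrier T. \<forall>Y\<in>carrier T. P (X \<boxtimes>\<^sub>1 Y) = H X Y"
    by (elim exE conjE) (rule that)
  \<comment> \<open>Unlike in the left case, linearity of \<open>p\<close> intervenes: the product
    (c \<boxtimes> d) \<star> (e \<boxtimes> f) puts E(d e) next to \<open>c\<close>, inside the
    argument of \<open>p\<close>, and right \<open>N\<close>-linearity brings it out again.\<close>
  have 1: "H X (Y \<star> Z) = H X Y \<star> Z" if X: "X \<in> carrier T" and Y: "Y \<in> carrier T" and Z: "Z \<in> carrier T" for X Y Z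
  proof (rule tensor_hom_eqI[OF add_hom_comp[OF E_mult_left_hom H] add_hom_comp[OF H E_mult_left_hom] Y])
    fix c d assume cd: "c \<in> carrier M" "d \<in> carrier M"
    show "H X (c \<boxtimes> d \<star> Z) = H X (c \<boxtimes> d) \<star> Z"
      by (rule tensor_hom_eqI[OF add_hom_comp[OF E_mult_right_hom H] E_mult_right_hom Z])
        (simp_all add: cd X pure_closed H_pure E_mult_pure E_closed p_closed T.rsmult_closed
          rsmult_rsmult[symmetric] p_right)
  qed (simp_all add: X Z)
  have 2: "H (m \<odot>\<^bsub>T\<^esub> X) Y = m \<odot>\<^bsub>T\<^esub> H X Y"
    if X: "X \<in> carrier T" and Y: "Y \<in> carrier T" and m: "m \<in> carrier M" for X Y m
    by (rule tensor_hom_eqI[OF H add_hom_comp[OF H T.smult_hom] Y])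
      (simp_all add: m X T.rsmult_closed T.smult_closed H_pure smult_pure smult_rsmult p_left p_closed)
  have "P (rsmult T2 W Z) = P W \<star> Z" if Z: "Z \<in> carrier T" and W: "W \<in> carrier T2" for Z W
    by (rule T2_hom_eqI[OF add_hom_comp[OF rsmult1_hom P] add_hom_comp[OF P E_mult_left_hom] W])
      (simp_all add: Z rsmult_pure1 P_pure E_mult_closed 1)
  moreover have "P (\<iota>1 m \<odot>\<^bsub>T2\<^esub> W) = \<iota>1 m \<star> P W" if m: "m \<in> carrier M" and W: "W \<in> carrier T2" for m W
    by (rule T2_hom_eqI[OF add_hom_comp[OF smult1_hom P] add_hom_comp[OF P E_mult_right_hom] W])
      (simp_all add: m map_closed smult_pure1 P_pure E_mult_closed E_mult_map_left 2 add_hom_closed[OF H] T.smult_closed)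
  moreover have "P (X \<boxtimes>\<^sub>1 (c \<boxtimes> d)) = p (rsmult T X c) \<boxtimes> d"
    if "X \<in> carrier T" "c \<in> carrier M" "d \<in> carrier M" for X c d
    by (simp add: that P_pure H_pure pure_closed)
  ultimately show ?thesis
    using P by (intro exI[of _ P]) simp
qed

text \<open>Now 1 \<boxtimes> b embeds the new last factor, and \<open>q\<close> fills the first
  slot.\<close>

lemma right_induced_up:
  assumes q: "q \<in> add_hom M T"
    and q_left: "\<And>m a. m \<in> carrier M \<Longrightarrow> a \<in> carrier M \<Longrightarrow> q (m \<otimes>\<^bsub>M\<^esub> a) = m \<odot>\<^bsub>T\<^esub> q a"
    and q_right: "\<And>n a. n \<in> carrier N \<Longrightarrow> a \<in> carrier M \<Longrightarrow> q (a \<otimes>\<^bsub>M\<^esub> \<iota> n) = rsmult T (q a) (\<iota> n)"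
  shows "\<exists>Q. Q \<in> add_hom T T2 \<and>
    (\<forall>a\<in>carrier M. \<forall>b\<in>carrier M. Q (a \<boxtimes> b) = q a \<boxtimes>\<^sub>1 (\<one>\<^bsub>M\<^esub> \<boxtimes> b)) \<and>
    (\<forall>m\<in>carrier M. \<forall>X\<in>carrier T. Q (\<iota>1 m \<star> X) = \<iota>1 m \<odot>\<^bsub>T2\<^esub> Q X) \<and>
    (\<forall>Z\<in>carrier T. \<forall>X\<in>carrier T. Q (X \<star> Z) = rsmult T2 (Q X) Z)"
proof -
  note q_closed = add_hom_closed[OF q] and q_add = add_hom_add[OF q]
  \<comment> \<open>Needed twice: with n itself for the balance of \<open>Q\<close> over
    \<open>N\<close>, and with n = E(b e) for right \<open>M1\<close>-linearity, where it turns q a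
    E(b e) against 1 \<boxtimes> f into \<open>q a\<close> against (1 \<boxtimes> b) \<star> (e
    \<boxtimes> f).\<close>
  have q_one: "rsmult T (q a) (\<iota> n) \<boxtimes>\<^sub>1 (\<one>\<^bsub>M\<^esub> \<boxtimes> b) = q a \<boxtimes>\<^sub>1 (\<iota> n \<boxtimes> b)"
    if "a \<in> carrier M" "b \<in> carrier M" "n \<in> carrier N" for a b n
    using that by (simp add: pure1_balanced pure_closed q_closed smult_pure)
  have "\<exists>Q. Q \<in> add_hom T T2 \<and>
    (\<forall>a\<in>carrier M. \<forall>b\<in>carrier M. Q (a \<boxtimes> b) = q a \<boxtimes>\<^sub>1 (\<one>\<^bsub>M\<^esub> \<boxtimes> b))"
  proof (rule tensor_lift[OF M1.T.abelian_group_axioms], goal_cases)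
    case (4 a n b)
    then show ?case
      using pure_balanced[of "\<one>\<^bsub>M\<^esub>" n b] by (simp add: q_right q_one)
  qed (simp_all add: pure1_closed pure_closed q_closed q_add pure_add_right
      add_hom_add[OF pure1_left_hom] add_hom_add[OF pure1_right_hom])
  then obtain Q where Q: "Q \<in> add_hom T T2"
    and Q_pure: "\<forall>a\<in>carrier M. \<forall>b\<in>carrier M. Q (a \<boxtimes> b) = q a \<boxtimes>\<^sub>1 (\<one>\<^bsub>M\<^esub> \<boxtimes> b)"
    by (elim exE conjE) (rule that)
  have "Q (X \<star> Z) = rsmult T2 (Q X) Z" if X: "X \<in> carrier T" and Z: "Z \<in> carrier T" for X Z
  proof (rule tensor_hom_eqI[OF add_hom_comp[OF E_mult_left_hom Q] add_hom_comp[OF Q rsmult1_hom] X])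
    fix a b assume ab: "a \<in> carrier M" "b \<in> carrier M"
    show "Q (a \<boxtimes> b \<star> Z) = rsmult T2 (Q (a \<boxtimes> b)) Z"
      by (rule tensor_hom_eqI[OF add_hom_comp[OF E_mult_right_hom Q] rsmult1_right_hom Z])
        (simp_all add: ab pure_closed Q_pure E_mult_pure E_closed q_closed q_right q_one pure1_closed rsmult_pure1)
  qed (simp_all add: Z)
  moreover have "Q (\<iota>1 m \<star> X) = \<iota>1 m \<odot>\<^bsub>T2\<^esub> Q X" if X: "X \<in> carrier T" and m: "m \<in> carrier M" for X m
    by (rule tensor_hom_eqI[OF add_hom_comp[OF E_mult_right_hom Q] add_hom_comp[OF Q smult1_hom] X])
      (simp_all add: m map_closed E_mult_map_left pure_closed smult_pure Q_pure smult_pure1 q_closed q_left)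
  ultimately show ?thesis
    using Q Q_pure by (intro exI[of _ Q]) simp
qed

section \<open>The two implications\<close>

lemma id_funcset: "id \<in> carrier R \<rightarrow> carrier R"
  by simp

text \<open>The exponent \<open>n\<close> is kept: each pair p_i, q_i induces one pair P_i, Q_i, and
  the sum of the Q_i P_i is the sum of the q_i p_i with a factor \<open>M\<close> tensored on the
  left.\<close>

lemma left_D2_imp_right_D2:
  assumes "left_D2 N M \<iota>"
  shows "right_D2 M M1 \<iota>1"
proof -
  obtain n :: nat where n: "n \<ge> 1" and iso: "iso_to_direct_summand N M
       (tensor_product N (restricted_bimodule \<iota> \<iota> M) (restricted_bimodule \<iota> id M))
       (bimodule_power n (restricted_bimodule \<iota> id M))"
    using assms unfolding left_D2_def by (elim exE conjE) (rule that)
  obtain p q where pq: "\<forall>i<n. p i \<in> add_hom T M \<and> q i \<in> add_hom M T \<and>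
        (\<forall>r\<in>carrier N. \<forall>X\<in>carrier T. p i (\<iota> r \<odot>\<^bsub>T\<^esub> X) = \<iota> r \<otimes>\<^bsub>M\<^esub> p i X) \<and>
        (\<forall>s\<in>carrier M. \<forall>X\<in>carrier T. p i (rsmult T X (id s)) = p i X \<otimes>\<^bsub>M\<^esub> id s) \<and>
        (\<forall>r\<in>carrier N. \<forall>a\<in>carrier M. q i (\<iota> r \<otimes>\<^bsub>M\<^esub> a) = \<iota> r \<odot>\<^bsub>T\<^esub> q i a) \<and>
        (\<forall>s\<in>carrier M. \<forall>a\<in>carrier M. q i (a \<otimes>\<^bsub>M\<^esub> id s) = rsmult T (q i a) (id s))"
    and sum: "\<forall>X\<in>carrier T. (\<Oplus>\<^bsub>T\<^esub>i\<in>{..<n}. q i (p i X)) = X"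
    using summand_of_power_iff[OF map_funcset id_funcset, THEN iffD1, OF iso]
    by (elim exE conjE) (rule that)
  have p: "p i \<in> add_hom T M" if "i < n" for i
    using pq that by simp
  have q: "q i \<in> add_hom M T" if "i < n" for i
    using pq that by simp
  have "\<forall>i\<in>{..<n}. \<exists>P. P \<in> add_hom T2 T \<and>
    (\<forall>a\<in>carrier M. \<forall>b\<in>carrier M. \<forall>Y\<in>carrier T. P ((a \<boxtimes> b) \<boxtimes>\<^sub>1 Y) = a \<boxtimes> p i (b \<odot>\<^bsub>T\<^esub> Y)) \<and>
    (\<forall>Z\<in>carrier T. \<forall>W\<in>carrier T2. P (Z \<odot>\<^bsub>T2\<^esub> W) = Z \<star> P W) \<and>
    (\<forall>m\<in>carrier M. \<forall>W\<in>carrier T2. P (rsmult T2 W (\<iota>1 m)) = P W \<star> \<iota>1 m)"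
    using pq by (intro ballI left_induced_down) simp_all
  then obtain P where P: "\<forall>i\<in>{..<n}. P i \<in> add_hom T2 T \<and>
    (\<forall>a\<in>carrier M. \<forall>b\<in>carrier M. \<forall>Y\<in>carrier T. P i ((a \<boxtimes> b) \<boxtimes>\<^sub>1 Y) = a \<boxtimes> p i (b \<odot>\<^bsub>T\<^esub> Y)) \<and>
    (\<forall>Z\<in>carrier T. \<forall>W\<in>carrier T2. P i (Z \<odot>\<^bsub>T2\<^esub> W) = Z \<star> P i W) \<and>
    (\<forall>m\<in>carrier M. \<forall>W\<in>carrier T2. P i (rsmult T2 W (\<iota>1 m)) = P i W \<star> \<iota>1 m)"
    by (elim bchoice[THEN exE])
  have "\<forall>i\<in>{..<n}. \<exists>Q. Q \<in> add_hom T T2 \<and>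
    (\<forall>a\<in>carrier M. \<forall>b\<in>carrier M. Q (a \<boxtimes> b) = (a \<boxtimes> \<one>\<^bsub>M\<^esub>) \<boxtimes>\<^sub>1 q i b) \<and>
    (\<forall>Z\<in>carrier T. \<forall>X\<in>carrier T. Q (Z \<star> X) = Z \<odot>\<^bsub>T2\<^esub> Q X) \<and>
    (\<forall>m\<in>carrier M. \<forall>X\<in>carrier T. Q (X \<star> \<iota>1 m) = rsmult T2 (Q X) (\<iota>1 m))"
  proof
    fix i assume "i \<in> {..<n}"
    then have i: "i < n" by simp
    show "\<exists>Q. Q \<in> add_hom T T2 \<and>
      (\<forall>a\<in>carrier M. \<forall>b\<in>carrier M. Q (a \<boxtimes> b) = (a \<boxtimes> \<one>\<^bsub>M\<^esub>) \<boxtimes>\<^sub>1 q i b) \<and>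
      (\<forall>Z\<in>carrier T. \<forall>X\<in>carrier T. Q (Z \<star> X) = Z \<odot>\<^bsub>T2\<^esub> Q X) \<and>
      (\<forall>m\<in>carrier M. \<forall>X\<in>carrier T. Q (X \<star> \<iota>1 m) = rsmult T2 (Q X) (\<iota>1 m))"
      using pq[THEN spec, THEN mp, OF i] unfolding id_apply by (intro left_induced_up) blast+
  qed
  then obtain Q where Q: "\<forall>i\<in>{..<n}. Q i \<in> add_hom T T2 \<and>
    (\<forall>a\<in>carrier M. \<forall>b\<in>carrier M. Q i (a \<boxtimes> b) = (a \<boxtimes> \<one>\<^bsub>M\<^esub>) \<boxtimes>\<^sub>1 q i b) \<and>
    (\<forall>Z\<in>carrier T. \<forall>X\<in>carrier T. Q i (Z \<star> X) = Z \<odot>\<^bsub>T2\<^esub> Q i X) \<and>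
    (\<forall>m\<in>carrier M. \<forall>X\<in>carrier T. Q i (X \<star> \<iota>1 m) = rsmult T2 (Q i X) (\<iota>1 m))"
    by (elim bchoice[THEN exE])
  have P_hom: "P i \<in> add_hom T2 T" and Q_hom: "Q i \<in> add_hom T T2" if "i \<in> {..<n}" for i
    using P Q that by simp_all
  have QP_hom: "(\<lambda>W. \<Oplus>\<^bsub>T2\<^esub>i\<in>{..<n}. Q i (P i W)) \<in> add_hom T2 T2"
    by (rule add_hom_finsum_fun[OF M1.T.abelian_group_axioms add_hom_comp[OF P_hom Q_hom]])
  \<comment> \<open>Two reductions to pure tensors, first in \<open>W\<close> and then in its left
    factor. On \<open>(a \<boxtimes> b) \<boxtimes>\<^sub>1 Y\<close> the hypothesis on the q_i p_i
    is applied to b Y.\<close>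
  have QP: "(\<Oplus>\<^bsub>T2\<^esub>i\<in>{..<n}. Q i (P i W)) = W" if W: "W \<in> carrier T2" for W
  proof (rule T2_hom_eqI[OF QP_hom add_homI W])
    fix X Y assume X: "X \<in> carrier T" and Y: "Y \<in> carrier T"
    show "(\<Oplus>\<^bsub>T2\<^esub>i\<in>{..<n}. Q i (P i (X \<boxtimes>\<^sub>1 Y))) = X \<boxtimes>\<^sub>1 Y"
    proof (rule tensor_hom_eqI[OF add_hom_comp[OF pure1_left_hom[OF Y] QP_hom] pure1_left_hom[OF Y] X])
      fix a b assume ab: "a \<in> carrier M" "b \<in> carrier M"
      have a1: "a \<boxtimes> \<one>\<^bsub>M\<^esub> \<in> carrier T" and bY: "b \<odot>\<^bsub>T\<^esub> Y \<in> carrier T"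
        using ab Y by (simp_all add: pure_closed T.smult_closed)
      have qp: "q i (p i (b \<odot>\<^bsub>T\<^esub> Y)) \<in> carrier T" if "i < n" for i
        using add_hom_closed[OF q add_hom_closed[OF p bY]] that by simp
      have "(\<Oplus>\<^bsub>T2\<^esub>i\<in>{..<n}. Q i (P i ((a \<boxtimes> b) \<boxtimes>\<^sub>1 Y))) =
        (\<Oplus>\<^bsub>T2\<^esub>i\<in>{..<n}. (a \<boxtimes> \<one>\<^bsub>M\<^esub>) \<boxtimes>\<^sub>1 q i (p i (b \<odot>\<^bsub>T\<^esub> Y)))"
        using ab Y P Q by (intro M1.T.finsum_cong') (auto simp: add_hom_closed[OF p bY] pure1_closed a1 qp)
      also have "\<dots> = (a \<boxtimes> \<one>\<^bsub>M\<^esub>) \<boxtimes>\<^sub>1 (\<Oplus>\<^bsub>T\<^esub>i\<in>{..<n}. q i (p i (b \<odot>\<^bsub>T\<^esub> Y)))"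
        by (rule add_hom_finsum[OF T.abelian_group_axioms M1.T.abelian_group_axioms pure1_right_hom[OF a1], symmetric])
          (auto simp: qp)
      also have "\<dots> = (a \<boxtimes> \<one>\<^bsub>M\<^esub>) \<boxtimes>\<^sub>1 (b \<odot>\<^bsub>T\<^esub> Y)"
        using sum bY by simp
      \<comment> \<open>The scalar b returns across the outer tensor sign, and (a \<boxtimes> 1) b =
        a \<boxtimes> b.\<close>
      also have "\<dots> = (a \<boxtimes> b) \<boxtimes>\<^sub>1 Y"
        using pure1_balanced[OF a1 ab(2) Y] ab by (simp add: rsmult_pure)
      finally show "(\<Oplus>\<^bsub>T2\<^esub>i\<in>{..<n}. Q i (P i ((a \<boxtimes> b) \<boxtimes>\<^sub>1 Y))) = (a \<boxtimes> b) \<boxtimes>\<^sub>1 Y" .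
    qed
  qed simp_all
  have "iso_to_direct_summand M1 M
       (tensor_product M (restricted_bimodule id \<iota>1 M1) (restricted_bimodule \<iota>1 \<iota>1 M1))
       (bimodule_power n (restricted_bimodule id \<iota>1 M1))"
    \<comment> \<open>The same criterion, now for the extension \<open>\<iota>1\<close> with the
      full ring \<open>M1\<close> acting on the left and \<open>M\<close> on the right.\<close>
    unfolding M1.summand_of_power_iff[OF id_funcset M1.map_funcset]
    unfolding add_hom_M1 unfolding M1_simps(1,2)
    using P Q QP by (intro exI[of _ P] exI[of _ Q]) simp
  then show ?thesis
    unfolding right_D2_def using n ring_hom_M1 by (intro conjI exI[of _ n])
qed

text \<open>The mirror image, again with the same \<open>n\<close>: the factor \<open>M\<close> is
  tensored on the right, and the hypothesis on the q_i p_i is applied to X c.\<close>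

lemma right_D2_imp_left_D2:
  assumes "right_D2 N M \<iota>"
  shows "left_D2 M M1 \<iota>1"
proof -
  obtain n :: nat where n: "n \<ge> 1" and iso: "iso_to_direct_summand M N
       (tensor_product N (restricted_bimodule id \<iota> M) (restricted_bimodule \<iota> \<iota> M))
       (bimodule_power n (restricted_bimodule id \<iota> M))"
    using assms unfolding right_D2_def by (elim exE conjE) (rule that)
  obtain p q where pq: "\<forall>i<n. p i \<in> add_hom T M \<and> q i \<in> add_hom M T \<and>
        (\<forall>r\<in>carrier M. \<forall>X\<in>carrier T. p i (id r \<odot>\<^bsub>T\<^esub> X) = id r \<otimes>\<^bsub>M\<^esub> p i X) \<and>
        (\<forall>s\<in>carrier N. \<forall>X\<in>carrier T. p i (rsmult T X (\<iota> s)) = p i X \<otimes>\<^bsub>M\<^esub> \<iota> s) \<and>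
        (\<forall>r\<in>carrier M. \<forall>a\<in>carrier M. q i (id r \<otimes>\<^bsub>M\<^esub> a) = id r \<odot>\<^bsub>T\<^esub> q i a) \<and>
        (\<forall>s\<in>carrier N. \<forall>a\<in>carrier M. q i (a \<otimes>\<^bsub>M\<^esub> \<iota> s) = rsmult T (q i a) (\<iota> s))"
    and sum: "\<forall>X\<in>carrier T. (\<Oplus>\<^bsub>T\<^esub>i\<in>{..<n}. q i (p i X)) = X"
    using summand_of_power_iff[OF id_funcset map_funcset, THEN iffD1, OF iso]
    by (elim exE conjE) (rule that)
  have p: "p i \<in> add_hom T M" if "i < n" for i
    using pq that by simp
  have q: "q i \<in> add_hom M T" if "i < n" for i
    using pq that by simp
  have "\<forall>i\<in>{..<n}. \<exists>P. P \<in> add_hom T2 T \<and>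
    (\<forall>X\<in>carrier T. \<forall>c\<in>carrier M. \<forall>d\<in>carrier M. P (X \<boxtimes>\<^sub>1 (c \<boxtimes> d)) = p i (rsmult T X c) \<boxtimes> d) \<and>
    (\<forall>m\<in>carrier M. \<forall>W\<in>carrier T2. P (\<iota>1 m \<odot>\<^bsub>T2\<^esub> W) = \<iota>1 m \<star> P W) \<and>
    (\<forall>Z\<in>carrier T. \<forall>W\<in>carrier T2. P (rsmult T2 W Z) = P W \<star> Z)"
    using pq by (intro ballI right_induced_down) simp_all
  then obtain P where P: "\<forall>i\<in>{..<n}. P i \<in> add_hom T2 T \<and>
    (\<forall>X\<in>carrier T. \<forall>c\<in>carrier M. \<forall>d\<in>carrier M. P i (X \<boxtimes>\<^sub>1 (c \<boxtimes> d)) = p i (rsmult T X c) \<boxtimes> d) \<and>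
    (\<forall>m\<in>carrier M. \<forall>W\<in>carrier T2. P i (\<iota>1 m \<odot>\<^bsub>T2\<^esub> W) = \<iota>1 m \<star> P i W) \<and>
    (\<forall>Z\<in>carrier T. \<forall>W\<in>carrier T2. P i (rsmult T2 W Z) = P i W \<star> Z)"
    by (elim bchoice[THEN exE])
  have "\<forall>i\<in>{..<n}. \<exists>Q. Q \<in> add_hom T T2 \<and>
    (\<forall>a\<in>carrier M. \<forall>b\<in>carrier M. Q (a \<boxtimes> b) = q i a \<boxtimes>\<^sub>1 (\<one>\<^bsub>M\<^esub> \<boxtimes> b)) \<and>
    (\<forall>m\<in>carrier M. \<forall>X\<in>carrier T. Q (\<iota>1 m \<star> X) = \<iota>1 m \<odot>\<^bsub>T2\<^esub> Q X) \<and>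
    (\<forall>Z\<in>carrier T. \<forall>X\<in>carrier T. Q (X \<star> Z) = rsmult T2 (Q X) Z)"
  proof
    fix i assume "i \<in> {..<n}"
    then have i: "i < n" by simp
    show "\<exists>Q. Q \<in> add_hom T T2 \<and>
      (\<forall>a\<in>carrier M. \<forall>b\<in>carrier M. Q (a \<boxtimes> b) = q i a \<boxtimes>\<^sub>1 (\<one>\<^bsub>M\<^esub> \<boxtimes> b)) \<and>
      (\<forall>m\<in>carrier M. \<forall>X\<in>carrier T. Q (\<iota>1 m \<star> X) = \<iota>1 m \<odot>\<^bsub>T2\<^esub> Q X) \<and>
      (\<forall>Z\<in>carrier T. \<forall>X\<in>carrier T. Q (X \<star> Z) = rsmult T2 (Q X) Z)"
      using pq[THEN spec, THEN mp, OF i] unfolding id_apply by (intro right_induced_up) blast+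
  qed
  then obtain Q where Q: "\<forall>i\<in>{..<n}. Q i \<in> add_hom T T2 \<and>
    (\<forall>a\<in>carrier M. \<forall>b\<in>carrier M. Q i (a \<boxtimes> b) = q i a \<boxtimes>\<^sub>1 (\<one>\<^bsub>M\<^esub> \<boxtimes> b)) \<and>
    (\<forall>m\<in>carrier M. \<forall>X\<in>carrier T. Q i (\<iota>1 m \<star> X) = \<iota>1 m \<odot>\<^bsub>T2\<^esub> Q i X) \<and>
    (\<forall>Z\<in>carrier T. \<forall>X\<in>carrier T. Q i (X \<star> Z) = rsmult T2 (Q i X) Z)"
    by (elim bchoice[THEN exE])
  have P_hom: "P i \<in> add_hom T2 T" and Q_hom: "Q i \<in> add_hom T T2" if "i \<in> {..<n}" for i
    using P Q that by simp_all
  have QP_hom: "(\<lambda>W. \<Oplus>\<^bsub>T2\<^esub>i\<in>{..<n}. Q i (P i W)) \<in> add_hom T2 T2"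
    by (rule add_hom_finsum_fun[OF M1.T.abelian_group_axioms add_hom_comp[OF P_hom Q_hom]])
  have QP: "(\<Oplus>\<^bsub>T2\<^esub>i\<in>{..<n}. Q i (P i W)) = W" if W: "W \<in> carrier T2" for W
  proof (rule T2_hom_eqI[OF QP_hom add_homI W])
    fix X Y assume X: "X \<in> carrier T" and Y: "Y \<in> carrier T"
    show "(\<Oplus>\<^bsub>T2\<^esub>i\<in>{..<n}. Q i (P i (X \<boxtimes>\<^sub>1 Y))) = X \<boxtimes>\<^sub>1 Y"
    proof (rule tensor_hom_eqI[OF add_hom_comp[OF pure1_right_hom[OF X] QP_hom] pure1_right_hom[OF X] Y])
      fix c d assume cd: "c \<in> carrier M" "d \<in> carrier M"
      have d1: "\<one>\<^bsub>M\<^esub> \<boxtimes> d \<in> carrier T" and Xc: "rsmult T X c \<in> carrier T"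
        using cd X by (simp_all add: pure_closed T.rsmult_closed)
      have qp: "q i (p i (rsmult T X c)) \<in> carrier T" if "i < n" for i
        using add_hom_closed[OF q add_hom_closed[OF p Xc]] that by simp
      have "(\<Oplus>\<^bsub>T2\<^esub>i\<in>{..<n}. Q i (P i (X \<boxtimes>\<^sub>1 (c \<boxtimes> d)))) =
        (\<Oplus>\<^bsub>T2\<^esub>i\<in>{..<n}. q i (p i (rsmult T X c)) \<boxtimes>\<^sub>1 (\<one>\<^bsub>M\<^esub> \<boxtimes> d))"
        using cd X P Q by (intro M1.T.finsum_cong') (auto simp: add_hom_closed[OF p Xc] pure1_closed d1 qp)
      also have "\<dots> = (\<Oplus>\<^bsub>T\<^esub>i\<in>{..<n}. q i (p i (rsmult T X c))) \<boxtimes>\<^sub>1 (\<one>\<^bsub>M\<^esub> \<boxtimes> d)"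
        by (rule add_hom_finsum[OF T.abelian_group_axioms M1.T.abelian_group_axioms pure1_left_hom[OF d1], symmetric])
          (auto simp: qp)
      also have "\<dots> = rsmult T X c \<boxtimes>\<^sub>1 (\<one>\<^bsub>M\<^esub> \<boxtimes> d)"
        using sum Xc by simp
      \<comment> \<open>Here c returns from \<open>X\<close> to the second slot, where c (1
        \<boxtimes> d) = c \<boxtimes> d.\<close>
      also have "\<dots> = X \<boxtimes>\<^sub>1 (c \<boxtimes> d)"
        using pure1_balanced[OF X cd(1) d1] cd by (simp add: smult_pure)
      finally show "(\<Oplus>\<^bsub>T2\<^esub>i\<in>{..<n}. Q i (P i (X \<boxtimes>\<^sub>1 (c \<boxtimes> d)))) = X \<boxtimes>\<^sub>1 (c \<boxtimes> d)" .
    qed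
  qed simp_all
  have "iso_to_direct_summand M M1
       (tensor_product M (restricted_bimodule \<iota>1 \<iota>1 M1) (restricted_bimodule \<iota>1 id M1))
       (bimodule_power n (restricted_bimodule \<iota>1 id M1))"
    unfolding M1.summand_of_power_iff[OF M1.map_funcset id_funcset]
    unfolding add_hom_M1 unfolding M1_simps(1,2)
    using P Q QP by (intro exI[of _ P] exI[of _ Q]) simp
  then show ?thesis
    unfolding left_D2_def using n ring_hom_M1 by (intro conjI exI[of _ n])
qed

end

theorem theorem6p7:
  fixes N :: "('n, 'c) ring_scheme" and M :: "('m, 'd) ring_scheme" and \<iota> :: "'n \<Rightarrow> 'm"
    and E :: "'m \<Rightarrow> 'n" and I :: "'i set" and x y :: "'i \<Rightarrow> 'm"
  assumes "frobenius_extension N M \<iota> E I x y"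
  shows "(left_D2 N M \<iota> \<longrightarrow>
            right_D2 M (basic_construction N M \<iota> E I x y) (basic_construction_map N M \<iota> I x y)) \<and>
         (right_D2 N M \<iota> \<longrightarrow>
            left_D2 M (basic_construction N M \<iota> E I x y) (basic_construction_map N M \<iota> I x y))"
proof -
  interpret frobenius_extension N M \<iota> E I x y
    by fact
  show ?thesis
    using left_D2_imp_right_D2 right_D2_imp_left_D2 by blast
qed

end
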